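(* Let $\mathbb{C}$ be a comonad on $\mathcal{R}(\sigma)$ or $\mathcal{R}_*(\sigma)$, with a fixed class of path coalgebras in $\mathrm{EM}(\mathbb{C})$. Suppose $\mathbb{C}$ preserves embeddings and that for every surjective coalgebra morphism $(A,\alpha)\to(B,\beta)$ in $\mathrm{EM}(\mathbb{C})$, if $(A,\alpha)$ is a path then so is $(B,\beta)$. Then for structures $A_1,A_2,B_1,B_2$, if $A_1\equiv_{\mathbb{C}}B_1$ and $A_2\equiv_{\mathbb{C}}B_2$, then $A_1\times A_2\equiv_{\mathbb{C}}B_1\times B_2$.
   Context: Embeddings: injective homomorphisms reflecting relations; $\mathbb{C}$ preserves embeddings if $\mathbb{C}(f)$ is an embedding whenever $f$ is. $\mathrm{EM}(\mathbb{C})$ is the category of Eilenberg–Moore coalgebras; a coalgebra morphism is surjective/an embedding if its underlying homomorphism is; a path embedding is an embedding whose domain is a path. A coalgebra morphism $f\colon X\to Y$ is a pathwise-embedding if $f\circ e$ is an embedding for each path embedding $e$ into $X$, and open if whenever $f\circ e=m\circ g$ with path embeddings $e\colon P\to X$, $m\colon Q\to Y$, there is $d\colon Q\to X$ with $e=d\circ g$, $m=f\circ d$. $A\equiv_{\mathbb{C}}B$ iff there is a span $(\mathbb{C}A,\delta_A)\leftarrow X\rightarrow(\mathbb{C}B,\delta_B)$ of open pathwise-embeddings in $\mathrm{EM}(\mathbb{C})$. Products: Cartesian product with componentwise relations (pair of points in the pointed case). *)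

theory Defs
  imports Main "HOL-Library.FuncSet"
begin

section \<open>Relational structures\<close>

text \<open>
  A relational signature is a partial map from symbols to arities; its domain is the set of
  relation symbols.  The point of a structure is \<open>Some p\<close> for pointed structures and \<open>None\<close>
  for plain ones, so that both kinds of category share one development.
\<close>

type_synonym 's signature = "'s \<rightharpoonup> nat"

record ('s, 'u) rel_struct =
  carrier :: "'u set"
  rel :: "'s \<Rightarrow> 'u list set"
  pt :: "'u option"

text \<open>
  HOL has no proper classes, so ``all structures'' means all structures whose carrier belongs to
  a family \<open>\<U>\<close> of small sets.  The family is arbitrary up to closure under subsets and binary
  Cartesian products; ordered pairs are coded in the ambient type by an injection \<open>pr\<close>.
  Nothing bounds the size of \<open>'u\<close> or forces \<open>\<U>\<close> to contain \<open>UNIV\<close>, so that a comonad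
  may raise cardinalities.
\<close>

definition set_universe :: "('u \<times> 'u \<Rightarrow> 'u) \<Rightarrow> 'u set set \<Rightarrow> bool" where
  "set_universe pr \<U> \<longleftrightarrow>
     inj pr \<and>
     (\<forall>S\<in>\<U>. \<forall>T. T \<subseteq> S \<longrightarrow> T \<in> \<U>) \<and>
     (\<forall>S\<in>\<U>. \<forall>T\<in>\<U>. pr ` (S \<times> T) \<in> \<U>)"

text \<open>
  The objects of \<open>\<R>(\<sigma>)\<close> (for \<open>pointed = False\<close>) and \<open>\<R>\<^sub>*(\<sigma>)\<close> (for \<open>pointed = True\<close>).
  Relations of symbols outside \<open>dom \<sigma>\<close> are forced to be empty.
\<close>

definition structs :: "'u set set \<Rightarrow> 's signature \<Rightarrow> bool \<Rightarrow> ('s, 'u) rel_struct set" where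
  "structs \<U> \<sigma> pointed =
     {A. carrier A \<in> \<U> \<and>
         (\<forall>R. \<forall>xs \<in> rel A R. \<sigma> R = Some (length xs) \<and> set xs \<subseteq> carrier A) \<and>
         (if pointed then \<exists>p \<in> carrier A. pt A = Some p else pt A = None)}"

text \<open>
  Morphisms are extensional functions, so HOL equality of morphisms is equality of arrows.
  Composition is \<^const>\<open>compose\<close> on the carrier of the source.
\<close>

definition hom :: "('s, 'u) rel_struct \<Rightarrow> ('s, 'u) rel_struct \<Rightarrow> ('u \<Rightarrow> 'u) set" where
  "hom A B =
     {f \<in> carrier A \<rightarrow>\<^sub>E carrier B.
        (\<forall>R. \<forall>xs \<in> rel A R. map f xs \<in> rel B R) \<and> map_option f (pt A) = pt B}"

abbreviation ident :: "('s, 'u) rel_struct \<Rightarrow> 'u \<Rightarrow> 'u" where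
  "ident A \<equiv> restrict (\<lambda>x. x) (carrier A)"

definition embedding ::
  "('s, 'u) rel_struct \<Rightarrow> ('s, 'u) rel_struct \<Rightarrow> ('u \<Rightarrow> 'u) \<Rightarrow> bool" where
  "embedding A B f \<longleftrightarrow>
     f \<in> hom A B \<and> inj_on f (carrier A) \<and>
     (\<forall>R xs. set xs \<subseteq> carrier A \<longrightarrow> map f xs \<in> rel B R \<longrightarrow> xs \<in> rel A R)"

definition struct_prod ::
  "('u \<times> 'u \<Rightarrow> 'u) \<Rightarrow> ('s, 'u) rel_struct \<Rightarrow> ('s, 'u) rel_struct \<Rightarrow> ('s, 'u) rel_struct" where
  "struct_prod pr A B =
     \<lparr>carrier = pr ` (carrier A \<times> carrier B),
      rel = (\<lambda>R. {map pr ps |ps. map fst ps \<in> rel A R \<and> map snd ps \<in> rel B R}),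
      pt = (case (pt A, pt B) of (Some a, Some b) \<Rightarrow> Some (pr (a, b)) | _ \<Rightarrow> None)\<rparr>"


section \<open>Comonads and Eilenberg--Moore coalgebras\<close>

text \<open>
  The action on an arrow \<open>f : A \<rightarrow> B\<close> is \<open>Map C A B f\<close>; source and target are explicit because
  \<open>f\<close> as a function does not determine its target, nor the relations on its source.
\<close>

record ('s, 'u) comonad =
  Ob :: "('s, 'u) rel_struct \<Rightarrow> ('s, 'u) rel_struct"
  Map :: "('s, 'u) rel_struct \<Rightarrow> ('s, 'u) rel_struct \<Rightarrow> ('u \<Rightarrow> 'u) \<Rightarrow> 'u \<Rightarrow> 'u"
  counit :: "('s, 'u) rel_struct \<Rightarrow> 'u \<Rightarrow> 'u"
  comult :: "('s, 'u) rel_struct \<Rightarrow> 'u \<Rightarrow> 'u"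

locale comonad_on =
  fixes K :: "('s, 'u) rel_struct set"
    and C :: "('s, 'u) comonad"
  assumes Ob_closed: "A \<in> K \<Longrightarrow> Ob C A \<in> K"
    and Map_hom: "\<lbrakk>A \<in> K; B \<in> K; f \<in> hom A B\<rbrakk> \<Longrightarrow> Map C A B f \<in> hom (Ob C A) (Ob C B)"
    and Map_ident: "A \<in> K \<Longrightarrow> Map C A A (ident A) = ident (Ob C A)"
    and Map_compose:
      "\<lbrakk>A \<in> K; B \<in> K; D \<in> K; f \<in> hom A B; g \<in> hom B D\<rbrakk> \<Longrightarrow>
       Map C A D (compose (carrier A) g f) =
       compose (carrier (Ob C A)) (Map C B D g) (Map C A B f)"
    and counit_hom: "A \<in> K \<Longrightarrow> counit C A \<in> hom (Ob C A) A"
    and counit_natural: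
      "\<lbrakk>A \<in> K; B \<in> K; f \<in> hom A B\<rbrakk> \<Longrightarrow>
       compose (carrier (Ob C A)) (counit C B) (Map C A B f) =
       compose (carrier (Ob C A)) f (counit C A)"
    and comult_hom: "A \<in> K \<Longrightarrow> comult C A \<in> hom (Ob C A) (Ob C (Ob C A))"
    and comult_natural:
      "\<lbrakk>A \<in> K; B \<in> K; f \<in> hom A B\<rbrakk> \<Longrightarrow>
       compose (carrier (Ob C A)) (comult C B) (Map C A B f) =
       compose (carrier (Ob C A)) (Map C (Ob C A) (Ob C B) (Map C A B f)) (comult C A)"
    and counit_comult:
      "A \<in> K \<Longrightarrow> compose (carrier (Ob C A)) (counit C (Ob C A)) (comult C A) = ident (Ob C A)"
    and Map_counit_comult:
      "A \<in> K \<Longrightarrow>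
       compose (carrier (Ob C A)) (Map C (Ob C A) A (counit C A)) (comult C A) = ident (Ob C A)"
    and coassoc:
      "A \<in> K \<Longrightarrow>
       compose (carrier (Ob C A)) (comult C (Ob C A)) (comult C A) =
       compose (carrier (Ob C A)) (Map C (Ob C A) (Ob C (Ob C A)) (comult C A)) (comult C A)"

definition preserves_embeddings :: "('s, 'u) rel_struct set \<Rightarrow> ('s, 'u) comonad \<Rightarrow> bool" where
  "preserves_embeddings K C \<longleftrightarrow>
     (\<forall>A\<in>K. \<forall>B\<in>K. \<forall>f. embedding A B f \<longrightarrow> embedding (Ob C A) (Ob C B) (Map C A B f))"

type_synonym ('s, 'u) coalg = "('s, 'u) rel_struct \<times> ('u \<Rightarrow> 'u)"

definition EM :: "('s, 'u) rel_struct set \<Rightarrow> ('s, 'u) comonad \<Rightarrow> ('s, 'u) coalg set" where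
  "EM K C =
     {(A, \<alpha>). A \<in> K \<and> \<alpha> \<in> hom A (Ob C A) \<and>
        compose (carrier A) (counit C A) \<alpha> = ident A \<and>
        compose (carrier A) (comult C A) \<alpha> = compose (carrier A) (Map C A (Ob C A) \<alpha>) \<alpha>}"

definition coalg_hom ::
  "('s, 'u) comonad \<Rightarrow> ('s, 'u) coalg \<Rightarrow> ('s, 'u) coalg \<Rightarrow> ('u \<Rightarrow> 'u) set" where
  "coalg_hom C X Y =
     {f \<in> hom (fst X) (fst Y).
        compose (carrier (fst X)) (Map C (fst X) (fst Y) f) (snd X) =
        compose (carrier (fst X)) (snd Y) f}"

definition cofree :: "('s, 'u) comonad \<Rightarrow> ('s, 'u) rel_struct \<Rightarrow> ('s, 'u) coalg" where
  "cofree C A = (Ob C A, comult C A)"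

definition surjective_coalg_hom ::
  "('s, 'u) comonad \<Rightarrow> ('s, 'u) coalg \<Rightarrow> ('s, 'u) coalg \<Rightarrow> ('u \<Rightarrow> 'u) \<Rightarrow> bool" where
  "surjective_coalg_hom C X Y f \<longleftrightarrow>
     f \<in> coalg_hom C X Y \<and> f ` carrier (fst X) = carrier (fst Y)"


section \<open>Paths, open pathwise-embeddings and the induced equivalence\<close>

definition path_embedding ::
  "('s, 'u) comonad \<Rightarrow> ('s, 'u) coalg set \<Rightarrow> ('s, 'u) coalg \<Rightarrow> ('s, 'u) coalg \<Rightarrow> ('u \<Rightarrow> 'u) \<Rightarrow> bool"
where
  "path_embedding C Paths P X e \<longleftrightarrow>
     P \<in> Paths \<and> e \<in> coalg_hom C P X \<and> embedding (fst P) (fst X) e"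

definition pathwise_embedding ::
  "('s, 'u) comonad \<Rightarrow> ('s, 'u) coalg set \<Rightarrow> ('s, 'u) coalg \<Rightarrow> ('s, 'u) coalg \<Rightarrow> ('u \<Rightarrow> 'u) \<Rightarrow> bool"
where
  "pathwise_embedding C Paths X Y f \<longleftrightarrow>
     f \<in> coalg_hom C X Y \<and>
     (\<forall>P e. path_embedding C Paths P X e \<longrightarrow>
        embedding (fst P) (fst Y) (compose (carrier (fst P)) f e))"

definition open_morphism ::
  "('s, 'u) comonad \<Rightarrow> ('s, 'u) coalg set \<Rightarrow> ('s, 'u) coalg \<Rightarrow> ('s, 'u) coalg \<Rightarrow> ('u \<Rightarrow> 'u) \<Rightarrow> bool"
where
  "open_morphism C Paths X Y f \<longleftrightarrow>
     f \<in> coalg_hom C X Y \<and>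
     (\<forall>P Q e m g.
        path_embedding C Paths P X e \<longrightarrow> path_embedding C Paths Q Y m \<longrightarrow> g \<in> coalg_hom C P Q \<longrightarrow>
        compose (carrier (fst P)) f e = compose (carrier (fst P)) m g \<longrightarrow>
        (\<exists>d \<in> coalg_hom C Q X.
           e = compose (carrier (fst P)) d g \<and> m = compose (carrier (fst Q)) f d))"

definition comonad_equiv ::
  "('s, 'u) rel_struct set \<Rightarrow> ('s, 'u) comonad \<Rightarrow> ('s, 'u) coalg set \<Rightarrow>
   ('s, 'u) rel_struct \<Rightarrow> ('s, 'u) rel_struct \<Rightarrow> bool"
where
  "comonad_equiv K C Paths A B \<longleftrightarrow>
     (\<exists>X \<in> EM K C. \<exists>f g.
        pathwise_embedding C Paths X (cofree C A) f \<and> open_morphism C Paths X (cofree C A) f \<and>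
        pathwise_embedding C Paths X (cofree C B) g \<and> open_morphism C Paths X (cofree C B) g)"

end

theory Submission
  imports Defs
begin

text \<open>
  Because \<open>C\<close> preserves embeddings, a subset \<open>S\<close> of a coalgebra whose structure map sends \<open>S\<close> into the
  image of \<open>C S\<close> carries a subcoalgebra; images of coalgebra morphisms and unions of such subsets
  are of this kind.  Hence Eilenberg--Moore coalgebras \<open>X\<close>, \<open>Y\<close> have a product, the largest
  subcoalgebra of the cofree coalgebra on the product of structures on which both projections are
  coalgebra morphisms.  Given spans \<open>X\<^sub>1\<close>, \<open>X\<^sub>2\<close> of open pathwise-embeddings, the span required
  is the product of \<open>X\<^sub>1\<close> and \<open>X\<^sub>2\<close>, followed by the isomorphism between the product of the
  cofree coalgebras on \<open>A\<^sub>1\<close>, \<open>A\<^sub>2\<close> and the cofree coalgebra on \<open>A\<^sub>1 \<times> A\<^sub>2\<close>.  A path embedding into a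
  product has components that need not be embeddings, but these factor through their images, which
  are paths by hypothesis; so the lifting and embedding properties of the factors apply.
\<close>

section \<open>Structures and embeddings\<close>

lemma structsD_rel:
  "A \<in> structs \<U> \<sigma> pointed \<Longrightarrow> xs \<in> rel A R \<Longrightarrow> set xs \<subseteq> carrier A"
  by (auto simp: structs_def)

lemma structsD_pt:
  "A \<in> structs \<U> \<sigma> pointed \<Longrightarrow> pt A = Some p \<Longrightarrow> p \<in> carrier A"
  by (auto simp: structs_def split: if_splits)

lemma structs_pt_None_iff:
  "A \<in> structs \<U> \<sigma> pointed \<Longrightarrow> pt A = None \<longleftrightarrow> \<not> pointed"
  by (auto simp: structs_def split: if_splits)

lemma hom_carrier: "f \<in> hom A B \<Longrightarrow> x \<in> carrier A \<Longrightarrow> f x \<in> carrier B"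
  by (auto simp: hom_def)

lemma hom_rel: "f \<in> hom A B \<Longrightarrow> xs \<in> rel A R \<Longrightarrow> map f xs \<in> rel B R"
  by (auto simp: hom_def)

lemma hom_pt: "f \<in> hom A B \<Longrightarrow> pt B = map_option f (pt A)"
  by (auto simp: hom_def)

lemma hom_extensional: "f \<in> hom A B \<Longrightarrow> f \<in> extensional (carrier A)"
  by (auto simp: hom_def PiE_def)

lemma homI:
  assumes "\<And>x. x \<in> carrier A \<Longrightarrow> f x \<in> carrier B" "f \<in> extensional (carrier A)"
    "\<And>R xs. xs \<in> rel A R \<Longrightarrow> map f xs \<in> rel B R" "map_option f (pt A) = pt B"
  shows "f \<in> hom A B"
  using assms by (auto simp: hom_def PiE_def)

lemma map_compose_on:
  "set xs \<subseteq> S \<Longrightarrow> map (compose S g f) xs = map g (map f xs)"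
  by (auto simp: compose_def)

text \<open>Turns an equation of arrows into a pointwise one on \<open>S\<close>. Outside
  \<open>S\<close> both sides are \<open>undefined\<close>, so nothing has to be checked
  there.\<close>

lemma compose_eq_iff:
  "compose S g f = restrict h S \<longleftrightarrow> (\<forall>x\<in>S. g (f x) = h x)"
  "compose S g f = compose S h k \<longleftrightarrow> (\<forall>x\<in>S. g (f x) = h (k x))"
proof -
  have "compose S g f = restrict h S \<longleftrightarrow> (\<forall>x\<in>S. g (f x) = h x)" for h
  proof
    assume "compose S g f = restrict h S"
    then have "compose S g f x = restrict h S x" for x by (rule fun_cong)
    then show "\<forall>x\<in>S. g (f x) = h x" by (metis compose_eq restrict_apply')
  next
    assume "\<forall>x\<in>S. g (f x) = h x"
    then show "compose S g f = restrict h S" unfolding compose_def by (intro restrict_ext) simp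
  qed
  from this[of h] this[of "\<lambda>x. h (k x)"]
  show "compose S g f = restrict h S \<longleftrightarrow> (\<forall>x\<in>S. g (f x) = h x)"
    "compose S g f = compose S h k \<longleftrightarrow> (\<forall>x\<in>S. g (f x) = h (k x))"
    by (simp_all only: compose_def)
qed

lemma hom_compose:
  assumes A: "A \<in> structs \<U> \<sigma> pointed" and f: "f \<in> hom A B" and g: "g \<in> hom B D"
  shows "compose (carrier A) g f \<in> hom A D"
proof (rule homI)
  show "map (compose (carrier A) g f) xs \<in> rel D R" if "xs \<in> rel A R" for R xs
    using map_compose_on[OF structsD_rel[OF A that]] hom_rel[OF g hom_rel[OF f that]] by metis
  show "map_option (compose (carrier A) g f) (pt A) = pt D"
    using hom_pt[OF f] hom_pt[OF g] structsD_pt[OF A]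
    by (cases "pt A") (auto simp: compose_eq)
qed (auto simp: compose_eq intro: hom_carrier[OF g] hom_carrier[OF f])

lemma embeddingD_hom: "embedding A B f \<Longrightarrow> f \<in> hom A B"
  by (simp add: embedding_def)

lemma embeddingD_inj:
  "embedding A B f \<Longrightarrow> f x = f y \<Longrightarrow> x \<in> carrier A \<Longrightarrow> y \<in> carrier A \<Longrightarrow> x = y"
  by (auto simp: embedding_def inj_on_def)

lemma embeddingD_rel:
  "embedding A B f \<Longrightarrow> set xs \<subseteq> carrier A \<Longrightarrow> map f xs \<in> rel B R \<Longrightarrow> xs \<in> rel A R"
  by (auto simp: embedding_def)

lemma embedding_compose:
  assumes A: "A \<in> structs \<U> \<sigma> pointed" and f: "embedding A B f" and g: "embedding B D g"
  shows "embedding A D (compose (carrier A) g f)"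
  unfolding embedding_def
proof (intro conjI allI impI)
  note hf = embeddingD_hom[OF f]
  show "compose (carrier A) g f \<in> hom A D"
    using hom_compose[OF A hf embeddingD_hom[OF g]] .
  show "inj_on (compose (carrier A) g f) (carrier A)"
    by (rule inj_onI)
      (auto simp: compose_eq hom_carrier[OF hf] dest!: embeddingD_inj[OF g] embeddingD_inj[OF f])
  fix R xs assume xs: "set xs \<subseteq> carrier A" and r: "map (compose (carrier A) g f) xs \<in> rel D R"
  have "set (map f xs) \<subseteq> carrier B" using xs hom_carrier[OF hf] by auto
  then have "map f xs \<in> rel B R"
    using embeddingD_rel[OF g] r map_compose_on[OF xs] by metis
  then show "xs \<in> rel A R" using embeddingD_rel[OF f xs] by blast
qed

text \<open>A relation between the images under \<open>f\<close> is carried on by \<open>g\<close>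
  to \<open>D\<close>, where the composite reflects it back to \<open>A\<close>; injectivity is
  inherited in the same way.\<close>

lemma embedding_of_compose:
  assumes f: "f \<in> hom A B" and g: "g \<in> hom B D"
    and gf: "embedding A D (compose (carrier A) g f)"
  shows "embedding A B f"
  unfolding embedding_def
proof (intro conjI allI impI)
  show "inj_on f (carrier A)"
    by (rule inj_onI) (rule embeddingD_inj[OF gf], auto simp: compose_eq)
  fix R xs assume xs: "set xs \<subseteq> carrier A" and r: "map f xs \<in> rel B R"
  have "map (compose (carrier A) g f) xs \<in> rel D R"
    using hom_rel[OF g r] map_compose_on[OF xs] by metis
  then show "xs \<in> rel A R" using embeddingD_rel[OF gf xs] by blast
qed (rule f)

text \<open>The embedding \<open>g\<close> reflects relations from \<open>D\<close>, so preservation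
  of relations can be tested after \<open>g\<close>. For the point, the common flag
  \<open>pointed\<close> ensures that \<open>A\<close> and \<open>B\<close> either both have one or
  both lack one, and injectivity of \<open>g\<close> identifies the image of the first with the
  second.\<close>

lemma hom_of_compose_embedding:
  assumes A: "A \<in> structs \<U> \<sigma> pointed" and B: "B \<in> structs \<U> \<sigma> pointed"
    and f: "f \<in> extensional (carrier A)" "\<And>x. x \<in> carrier A \<Longrightarrow> f x \<in> carrier B"
    and g: "embedding B D g" and gf: "compose (carrier A) g f \<in> hom A D"
  shows "f \<in> hom A B"
proof (rule homI)
  fix R xs assume r: "xs \<in> rel A R"
  note xs = structsD_rel[OF A r]
  have "set (map f xs) \<subseteq> carrier B" using xs f(2) by auto
  then show "map f xs \<in> rel B R"
    using embeddingD_rel[OF g] hom_rel[OF gf r] map_compose_on[OF xs] by metis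
next
  show "map_option f (pt A) = pt B"
  proof (cases pointed)
    case False
    then show ?thesis using structs_pt_None_iff[OF A] structs_pt_None_iff[OF B] by simp
  next
    case True
    then obtain a b where ab: "pt A = Some a" "pt B = Some b"
      using structs_pt_None_iff[OF A] structs_pt_None_iff[OF B] by auto
    have a: "a \<in> carrier A" and b: "b \<in> carrier B"
      using structsD_pt[OF A ab(1)] structsD_pt[OF B ab(2)] .
    have "g (f a) = g b"
      using hom_pt[OF gf] hom_pt[OF embeddingD_hom[OF g]] ab a by (simp add: compose_eq)
    then show ?thesis using embeddingD_inj[OF g _ f(2)[OF a] b] ab by simp
  qed
qed (use f in auto)

section \<open>Induced substructures\<close>

definition substruct :: "('s, 'u) rel_struct \<Rightarrow> 'u set \<Rightarrow> ('s, 'u) rel_struct" where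
  "substruct A S = \<lparr>carrier = S, rel = (\<lambda>R. {xs \<in> rel A R. set xs \<subseteq> S}), pt = pt A\<rparr>"

lemma substruct_simps [simp]:
  "carrier (substruct A S) = S"
  "rel (substruct A S) R = {xs \<in> rel A R. set xs \<subseteq> S}"
  "pt (substruct A S) = pt A"
  by (simp_all add: substruct_def)

lemma hom_substructI:
  "\<lbrakk>f \<in> hom A B; A \<in> structs \<U> \<sigma> pointed; f ` carrier A \<subseteq> S\<rbrakk> \<Longrightarrow> f \<in> hom A (substruct B S)"
  by (rule homI)
    (fastforce dest: hom_rel hom_extensional structsD_rel simp: hom_pt image_subset_iff)+

text \<open>\<open>substruct\<close> keeps the point of \<open>A\<close>, and the restricted
  identity fixes that point only if it lies in \<open>S\<close>; hence the third assumption.\<close>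

lemma embedding_incl:
  assumes "A \<in> structs \<U> \<sigma> pointed" "S \<subseteq> carrier A" "set_option (pt A) \<subseteq> S"
  shows "embedding (substruct A S) A (ident (substruct A S))"
proof -
  have [simp]: "map (restrict (\<lambda>x. x) S) xs = xs" if "set xs \<subseteq> S" for xs
    using that by (auto intro!: map_idI)
  show ?thesis
    using assms unfolding embedding_def
    by (auto intro!: homI inj_onI) (cases "pt A"; auto)+
qed

text \<open>An arrow with values in \<open>S\<close> and its corestriction are one and the same
  function, so corestricting needs no new symbol.\<close>

lemma compose_incl:
  "\<lbrakk>f \<in> extensional (carrier A); f ` carrier A \<subseteq> S\<rbrakk> \<Longrightarrow>
   compose (carrier A) (ident (substruct B S)) f = f"
  by (rule extensionalityI[of _ "carrier A"]) (auto simp: compose_eq)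

section \<open>Products of structures\<close>

definition pair ::
  "('u \<times> 'u \<Rightarrow> 'u) \<Rightarrow> ('s, 'u) rel_struct \<Rightarrow> ('u \<Rightarrow> 'u) \<Rightarrow> ('u \<Rightarrow> 'u) \<Rightarrow> 'u \<Rightarrow> 'u" where
  "pair pr W f g = restrict (\<lambda>x. pr (f x, g x)) (carrier W)"

text \<open>\<open>inv pr\<close> decodes a coded pair, correctly so because \<open>pr\<close> is
  injective wherever this is used.\<close>

definition proj1 ::
  "('u \<times> 'u \<Rightarrow> 'u) \<Rightarrow> ('s, 'u) rel_struct \<Rightarrow> ('s, 'u) rel_struct \<Rightarrow> 'u \<Rightarrow> 'u" where
  "proj1 pr A B = restrict (\<lambda>z. fst (inv pr z)) (carrier (struct_prod pr A B))"

definition proj2 ::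
  "('u \<times> 'u \<Rightarrow> 'u) \<Rightarrow> ('s, 'u) rel_struct \<Rightarrow> ('s, 'u) rel_struct \<Rightarrow> 'u \<Rightarrow> 'u" where
  "proj2 pr A B = restrict (\<lambda>z. snd (inv pr z)) (carrier (struct_prod pr A B))"

lemma struct_prod_simps:
  "carrier (struct_prod pr A B) = pr ` (carrier A \<times> carrier B)"
  "rel (struct_prod pr A B) R = {map pr ps |ps. map fst ps \<in> rel A R \<and> map snd ps \<in> rel B R}"
  "pt (struct_prod pr A B) = (case (pt A, pt B) of (Some a, Some b) \<Rightarrow> Some (pr (a, b)) | _ \<Rightarrow> None)"
  by (simp_all add: struct_prod_def)

lemma struct_prod_in_structs:
  assumes U: "set_universe pr \<U>"
    and A: "A \<in> structs \<U> \<sigma> pointed" and B: "B \<in> structs \<U> \<sigma> pointed"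
  shows "struct_prod pr A B \<in> structs \<U> \<sigma> pointed"
proof -
  have "carrier (struct_prod pr A B) \<in> \<U>"
    using U A B by (auto simp: set_universe_def structs_def struct_prod_simps)
  moreover have "\<sigma> R = Some (length xs) \<and> set xs \<subseteq> carrier (struct_prod pr A B)"
    if "xs \<in> rel (struct_prod pr A B) R" for R xs
  proof -
    from that obtain ps where ps: "xs = map pr ps" "map fst ps \<in> rel A R" "map snd ps \<in> rel B R"
      by (auto simp: struct_prod_simps)
    have "\<sigma> R = Some (length (map fst ps))" using A ps(2) unfolding structs_def by blast
    moreover have "set ps \<subseteq> carrier A \<times> carrier B"
      using structsD_rel[OF A ps(2)] structsD_rel[OF B ps(3)] by force
    ultimately show ?thesis using ps(1) by (auto simp: struct_prod_simps)
  qed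
  moreover have "if pointed then \<exists>p\<in>carrier (struct_prod pr A B). pt (struct_prod pr A B) = Some p
    else pt (struct_prod pr A B) = None"
    using A B by (cases pointed) (auto simp: structs_def struct_prod_simps image_iff, blast)
  ultimately show ?thesis by (simp add: structs_def)
qed

lemma proj_hom:
  assumes pr: "inj pr" and A: "A \<in> structs \<U> \<sigma> pointed" and B: "B \<in> structs \<U> \<sigma> pointed"
  shows "proj1 pr A B \<in> hom (struct_prod pr A B) A"
    and "proj2 pr A B \<in> hom (struct_prod pr A B) B"
proof -
  have *: "set ps \<subseteq> carrier A \<times> carrier B"
    if "map fst ps \<in> rel A R" "map snd ps \<in> rel B R" for ps R
    using structsD_rel[OF A that(1)] structsD_rel[OF B that(2)] by force
  have m1: "map (proj1 pr A B) (map pr ps) = map fst ps" if "set ps \<subseteq> carrier A \<times> carrier B" for ps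
    using that pr by (auto simp: proj1_def struct_prod_simps)
  have m2: "map (proj2 pr A B) (map pr ps) = map snd ps" if "set ps \<subseteq> carrier A \<times> carrier B" for ps
    using that pr by (auto simp: proj2_def struct_prod_simps)
  \<comment> \<open>Were only one factor pointed, the product would have no point and a projection
    would fail to preserve points. The common flag excludes this.\<close>
  have None: "pt A = None \<longleftrightarrow> pt B = None"
    using structs_pt_None_iff[OF A] structs_pt_None_iff[OF B] by simp
  show "proj1 pr A B \<in> hom (struct_prod pr A B) A"
  proof (rule homI)
    show "map (proj1 pr A B) xs \<in> rel A R" if "xs \<in> rel (struct_prod pr A B) R" for R xs
      using that * m1 by (auto simp: struct_prod_simps(2) simp del: map_map)
    show "map_option (proj1 pr A B) (pt (struct_prod pr A B)) = pt A"
      using None pr structsD_pt[OF A] structsD_pt[OF B]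
      by (cases "pt A"; cases "pt B") (auto simp: struct_prod_simps proj1_def)
  qed (use pr in \<open>auto simp: proj1_def struct_prod_simps\<close>)
  show "proj2 pr A B \<in> hom (struct_prod pr A B) B"
  proof (rule homI)
    show "map (proj2 pr A B) xs \<in> rel B R" if "xs \<in> rel (struct_prod pr A B) R" for R xs
      using that * m2 by (auto simp: struct_prod_simps(2) simp del: map_map)
    show "map_option (proj2 pr A B) (pt (struct_prod pr A B)) = pt B"
      using None pr structsD_pt[OF A] structsD_pt[OF B]
      by (cases "pt A"; cases "pt B") (auto simp: struct_prod_simps proj2_def)
  qed (use pr in \<open>auto simp: proj2_def struct_prod_simps\<close>)
qed

lemma pair_hom:
  assumes W: "W \<in> structs \<U> \<sigma> pointed" and f: "f \<in> hom W A" and g: "g \<in> hom W B"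
  shows "pair pr W f g \<in> hom W (struct_prod pr A B)"
proof (rule homI)
  fix R xs assume r: "xs \<in> rel W R"
  have "map (pair pr W f g) xs = map pr (map (\<lambda>x. (f x, g x)) xs)"
    using structsD_rel[OF W r] by (auto simp: pair_def)
  moreover have "map fst (map (\<lambda>x. (f x, g x)) xs) \<in> rel A R" "map snd (map (\<lambda>x. (f x, g x)) xs) \<in> rel B R"
    using hom_rel[OF f r] hom_rel[OF g r] by (simp_all add: comp_def)
  ultimately show "map (pair pr W f g) xs \<in> rel (struct_prod pr A B) R"
    unfolding struct_prod_simps(2) by blast
next
  show "map_option (pair pr W f g) (pt W) = pt (struct_prod pr A B)"
    using hom_pt[OF f] hom_pt[OF g] structsD_pt[OF W]
    by (cases "pt W") (auto simp: pair_def struct_prod_simps)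
qed (use hom_carrier[OF f] hom_carrier[OF g] in \<open>auto simp: pair_def struct_prod_simps\<close>)

lemma proj_pair:
  assumes "inj pr" "f \<in> hom W A" "g \<in> hom W B" "x \<in> carrier W"
  shows "proj1 pr A B (pair pr W f g x) = f x" "proj2 pr A B (pair pr W f g x) = g x"
  using assms hom_carrier[OF assms(2,4)] hom_carrier[OF assms(3,4)]
  by (auto simp: proj1_def proj2_def pair_def struct_prod_simps)

lemma pr_proj:
  "inj pr \<Longrightarrow> z \<in> carrier (struct_prod pr A B) \<Longrightarrow> pr (proj1 pr A B z, proj2 pr A B z) = z"
  by (auto simp: proj1_def proj2_def struct_prod_simps)

definition prod_map ::
  "('u \<times> 'u \<Rightarrow> 'u) \<Rightarrow> ('s, 'u) rel_struct \<Rightarrow> ('s, 'u) rel_struct \<Rightarrow> ('u \<Rightarrow> 'u) \<Rightarrow> ('u \<Rightarrow> 'u) \<Rightarrow>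
   'u \<Rightarrow> 'u" where
  "prod_map pr A B f g =
     pair pr (struct_prod pr A B)
       (compose (carrier (struct_prod pr A B)) f (proj1 pr A B))
       (compose (carrier (struct_prod pr A B)) g (proj2 pr A B))"

lemma prod_map_hom:
  assumes pr: "inj pr" and A: "A \<in> structs \<U> \<sigma> pointed" and B: "B \<in> structs \<U> \<sigma> pointed"
    and AB: "struct_prod pr A B \<in> structs \<U> \<sigma> pointed"
    and f: "f \<in> hom A D" and g: "g \<in> hom B E"
  shows "prod_map pr A B f g \<in> hom (struct_prod pr A B) (struct_prod pr D E)"
  unfolding prod_map_def
  by (rule pair_hom[OF AB hom_compose[OF AB proj_hom(1)[OF pr A B] f]
        hom_compose[OF AB proj_hom(2)[OF pr A B] g]])

lemma prod_map_apply:
  "\<lbrakk>inj pr; a \<in> carrier A; b \<in> carrier B\<rbrakk> \<Longrightarrow> prod_map pr A B f g (pr (a, b)) = pr (f a, g b)"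
  by (auto simp: prod_map_def pair_def compose_def proj1_def proj2_def struct_prod_simps)

lemma prod_map_pair:
  assumes "inj pr" "r \<in> hom W A" "s \<in> hom W B"
  shows "compose (carrier W) (prod_map pr A B f g) (pair pr W r s) =
    pair pr W (compose (carrier W) f r) (compose (carrier W) g s)"
  using prod_map_apply[OF assms(1) hom_carrier[OF assms(2)] hom_carrier[OF assms(3)]]
  by (auto intro!: extensionalityI[of _ "carrier W"] simp: compose_eq pair_def)

lemma embedding_prod_map:
  assumes pr: "inj pr" and A: "A \<in> structs \<U> \<sigma> pointed" and B: "B \<in> structs \<U> \<sigma> pointed"
    and AB: "struct_prod pr A B \<in> structs \<U> \<sigma> pointed"
    and f: "embedding A D f" and g: "embedding B E g"
  shows "embedding (struct_prod pr A B) (struct_prod pr D E) (prod_map pr A B f g)"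
    (is "embedding ?P _ ?h")
proof -
  note h = prod_map_apply[OF pr, of _ A _ B f g]
  have "?h \<in> hom ?P (struct_prod pr D E)"
    by (rule prod_map_hom[OF pr A B AB embeddingD_hom[OF f] embeddingD_hom[OF g]])
  moreover have "inj_on ?h (carrier ?P)"
  proof (rule inj_onI)
    fix x y assume "x \<in> carrier ?P" "y \<in> carrier ?P" and eq: "?h x = ?h y"
    then obtain a b a' b' where
      x: "x = pr (a, b)" "a \<in> carrier A" "b \<in> carrier B" and
      y: "y = pr (a', b')" "a' \<in> carrier A" "b' \<in> carrier B"
      by (auto simp: struct_prod_simps)
    have "pr (f a, g b) = pr (f a', g b')"
      using eq h[OF x(2,3)] h[OF y(2,3)] unfolding x(1) y(1) by (rule box_equals)
    then have "f a = f a'" "g b = g b'"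
      using injD[OF pr] by blast+
    then show "x = y" using x y embeddingD_inj[OF f] embeddingD_inj[OF g] by blast
  qed
  moreover have "xs \<in> rel ?P R"
    if xs: "set xs \<subseteq> carrier ?P" and r: "map ?h xs \<in> rel (struct_prod pr D E) R" for R xs
  proof -
    \<comment> \<open>Decoding \<open>xs\<close> into a list of pairs allows comparison, by
      injectivity of \<open>pr\<close>, with the list \<open>qs\<close> that witnesses the relation
      in the target; the two components are then reflected by \<open>f\<close> and \<open>g\<close>
      separately.\<close>
    define ps where "ps = map (inv pr) xs"
    have inv: "pr (inv pr z) = z" "inv pr z \<in> carrier A \<times> carrier B" if "z \<in> set xs" for z
      using xs that pr by (force simp: struct_prod_simps)+
    have ps: "xs = map pr ps" "set ps \<subseteq> carrier A \<times> carrier B"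
      using inv unfolding ps_def by (simp add: comp_def map_idI) (use inv(2) in force)
    obtain qs where qs: "map ?h xs = map pr qs" "map fst qs \<in> rel D R" "map snd qs \<in> rel E R"
      using r by (auto simp: struct_prod_simps(2))
    have "map ?h xs = map pr (map (\<lambda>(a, b). (f a, g b)) ps)"
      unfolding ps(1) map_map using ps(2) h by (intro map_cong) auto
    then have "qs = map (\<lambda>(a, b). (f a, g b)) ps"
      using qs(1) pr by (metis inj_map_eq_map)
    then have "map f (map fst ps) \<in> rel D R" "map g (map snd ps) \<in> rel E R"
      using qs by (simp_all add: comp_def case_prod_beta)
    moreover have "set (map fst ps) \<subseteq> carrier A" "set (map snd ps) \<subseteq> carrier B"
      using ps(2) by auto
    ultimately have "map fst ps \<in> rel A R" "map snd ps \<in> rel B R"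
      using embeddingD_rel[OF f] embeddingD_rel[OF g] by blast+
    then show ?thesis using ps(1) by (auto simp: struct_prod_simps(2))
  qed
  ultimately show ?thesis by (auto simp: embedding_def)
qed

section \<open>Coalgebras and their subcoalgebras\<close>

locale embedding_comonad = comonad_on "structs \<U> \<sigma> pointed" C
  for \<U> :: "'u set set" and \<sigma> :: "'s signature" and pointed and C :: "('s, 'u) comonad" +
  fixes pr :: "'u \<times> 'u \<Rightarrow> 'u"
  assumes universe: "set_universe pr \<U>"
    and preserves: "preserves_embeddings (structs \<U> \<sigma> pointed) C"
begin

abbreviation K where "K \<equiv> structs \<U> \<sigma> pointed"

lemma inj_pr: "inj pr"
  using universe by (simp add: set_universe_def)

lemmas prod_K = struct_prod_in_structs[OF universe]

lemma Map_embedding: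
  "\<lbrakk>A \<in> K; B \<in> K; embedding A B f\<rbrakk> \<Longrightarrow> embedding (Ob C A) (Ob C B) (Map C A B f)"
  using preserves by (auto simp: preserves_embeddings_def)

lemma Map_compose_apply:
  assumes "A \<in> K" "B \<in> K" "D \<in> K" "f \<in> hom A B" "g \<in> hom B D" "z \<in> carrier (Ob C A)"
  shows "Map C A D (compose (carrier A) g f) z = Map C B D g (Map C A B f z)"
  using Map_compose[OF assms(1-5)] assms(6) by (simp add: compose_eq)

lemma counit_natural_apply:
  assumes "A \<in> K" "B \<in> K" "f \<in> hom A B" "z \<in> carrier (Ob C A)"
  shows "counit C B (Map C A B f z) = f (counit C A z)"
  using fun_cong[OF counit_natural[OF assms(1-3)], of z] assms(4) by (simp add: compose_eq)

lemma comult_natural_apply: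
  assumes "A \<in> K" "B \<in> K" "f \<in> hom A B" "z \<in> carrier (Ob C A)"
  shows "comult C B (Map C A B f z) = Map C (Ob C A) (Ob C B) (Map C A B f) (comult C A z)"
  using fun_cong[OF comult_natural[OF assms(1-3)], of z] assms(4) by (simp add: compose_eq)

lemma EM_iff:
  "(A, \<alpha>) \<in> EM K C \<longleftrightarrow> A \<in> K \<and> \<alpha> \<in> hom A (Ob C A) \<and>
     (\<forall>x\<in>carrier A. counit C A (\<alpha> x) = x) \<and>
     (\<forall>x\<in>carrier A. comult C A (\<alpha> x) = Map C A (Ob C A) \<alpha> (\<alpha> x))"
  by (simp add: EM_def compose_eq_iff)

lemma EM_K: "X \<in> EM K C \<Longrightarrow> fst X \<in> K"
  and EM_hom: "X \<in> EM K C \<Longrightarrow> snd X \<in> hom (fst X) (Ob C (fst X))"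
  and EM_counit: "X \<in> EM K C \<Longrightarrow> x \<in> carrier (fst X) \<Longrightarrow> counit C (fst X) (snd X x) = x"
  and EM_comult: "X \<in> EM K C \<Longrightarrow> x \<in> carrier (fst X) \<Longrightarrow>
    comult C (fst X) (snd X x) = Map C (fst X) (Ob C (fst X)) (snd X) (snd X x)"
  by (cases X; simp add: EM_iff)+

lemma coalg_hom_iff:
  "f \<in> coalg_hom C X Y \<longleftrightarrow> f \<in> hom (fst X) (fst Y) \<and>
     (\<forall>x\<in>carrier (fst X). Map C (fst X) (fst Y) f (snd X x) = snd Y (f x))"
  by (simp add: coalg_hom_def compose_eq_iff)

lemma coalg_hom_hom: "f \<in> coalg_hom C X Y \<Longrightarrow> f \<in> hom (fst X) (fst Y)"
  by (simp add: coalg_hom_def)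

lemma coalg_hom_compose:
  assumes X: "X \<in> EM K C" and Y: "Y \<in> EM K C" and Z: "Z \<in> EM K C"
    and f: "f \<in> coalg_hom C X Y" and g: "g \<in> coalg_hom C Y Z"
  shows "compose (carrier (fst X)) g f \<in> coalg_hom C X Z"
proof -
  have "Map C (fst X) (fst Z) (compose (carrier (fst X)) g f) (snd X x) =
      snd Z (compose (carrier (fst X)) g f x)" if "x \<in> carrier (fst X)" for x
    using that f g hom_carrier[OF coalg_hom_hom[OF f] that] hom_carrier[OF EM_hom[OF X] that]
    by (simp add: Map_compose_apply[OF EM_K[OF X] EM_K[OF Y] EM_K[OF Z]] coalg_hom_iff compose_eq)
  then show ?thesis
    using hom_compose[OF EM_K[OF X] coalg_hom_hom[OF f] coalg_hom_hom[OF g]]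
    by (simp add: coalg_hom_iff)
qed

section \<open>Cofree coalgebras and their adjunction\<close>

lemma cofree_simps [simp]: "fst (cofree C A) = Ob C A" "snd (cofree C A) = comult C A"
  by (simp_all add: cofree_def)

lemma cofree_EM:
  assumes A: "A \<in> K" shows "cofree C A \<in> EM K C"
  using Ob_closed[OF A] comult_hom[OF A] counit_comult[OF A] coassoc[OF A]
  by (simp add: cofree_def EM_def)

lemma Map_coalg_hom:
  assumes "A \<in> K" "B \<in> K" "f \<in> hom A B"
  shows "Map C A B f \<in> coalg_hom C (cofree C A) (cofree C B)"
  using Map_hom[OF assms] comult_natural_apply[OF assms] by (simp add: coalg_hom_iff)

text \<open>The adjunction between the forgetful functor and \<open>cofree\<close>: a homomorphism
  from the underlying structure of \<open>X\<close> to \<open>A\<close> becomes a coalgebra morphism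
  into \<open>cofree C A\<close>. Composition with the counit is the inverse.\<close>

definition transpose :: "('s, 'u) coalg \<Rightarrow> ('s, 'u) rel_struct \<Rightarrow> ('u \<Rightarrow> 'u) \<Rightarrow> 'u \<Rightarrow> 'u" where
  "transpose X A f = compose (carrier (fst X)) (Map C (fst X) A f) (snd X)"

lemma snd_coalg_hom:
  assumes X: "X \<in> EM K C" shows "snd X \<in> coalg_hom C X (cofree C (fst X))"
  using EM_hom[OF X] EM_comult[OF X] by (simp add: coalg_hom_iff)

lemma transpose_coalg_hom:
  assumes X: "X \<in> EM K C" and A: "A \<in> K" and f: "f \<in> hom (fst X) A"
  shows "transpose X A f \<in> coalg_hom C X (cofree C A)"
  unfolding transpose_def
  by (rule coalg_hom_compose[OF X cofree_EM[OF EM_K[OF X]] cofree_EM[OF A] snd_coalg_hom[OF X]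
        Map_coalg_hom[OF EM_K[OF X] A f]])

text \<open>Naturality moves the counit past the image of \<open>f\<close> under \<open>C\<close>,
  and the counit law of \<open>X\<close> then cancels the structure map.\<close>

lemma counit_transpose:
  assumes X: "X \<in> EM K C" and A: "A \<in> K" and f: "f \<in> hom (fst X) A" and x: "x \<in> carrier (fst X)"
  shows "counit C A (transpose X A f x) = f x"
  using counit_natural_apply[OF EM_K[OF X] A f] hom_carrier[OF EM_hom[OF X] x] EM_counit[OF X x] x
  by (simp add: transpose_def compose_eq)

text \<open>Since \<open>m\<close> is a coalgebra morphism, the structure map of \<open>X\<close>
  can be exchanged for the comultiplication after \<open>m\<close>, which the law
  \<open>Map_counit_comult\<close> cancels.\<close>

lemma transpose_counit:
  assumes X: "X \<in> EM K C" and A: "A \<in> K" and m: "m \<in> coalg_hom C X (cofree C A)"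
  shows "transpose X A (compose (carrier (fst X)) (counit C A) m) = m"
proof (rule extensionalityI[of _ "carrier (fst X)"])
  have m': "m \<in> hom (fst X) (Ob C A)" using coalg_hom_hom[OF m] by simp
  show "m \<in> extensional (carrier (fst X))" by (rule hom_extensional[OF m'])
  fix x assume x: "x \<in> carrier (fst X)"
  have "transpose X A (compose (carrier (fst X)) (counit C A) m) x =
      Map C (Ob C A) A (counit C A) (Map C (fst X) (Ob C A) m (snd X x))"
    using Map_compose_apply[OF EM_K[OF X] Ob_closed[OF A] A m' counit_hom[OF A]
        hom_carrier[OF EM_hom[OF X] x]] x
    by (simp add: transpose_def compose_eq)
  also have "\<dots> = Map C (Ob C A) A (counit C A) (comult C A (m x))"
    using m x by (simp add: coalg_hom_iff)
  also have "\<dots> = m x"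
    using fun_cong[OF Map_counit_comult[OF A], of "m x"] hom_carrier[OF m' x]
    by (simp add: compose_eq)
  finally show "transpose X A (compose (carrier (fst X)) (counit C A) m) x = m x" .
qed (simp add: transpose_def)

text \<open>Transposition recovers a morphism into a cofree coalgebra from its composite with the
  counit.\<close>

lemma cofree_hom_eqI:
  assumes X: "X \<in> EM K C" and A: "A \<in> K"
    and m: "m \<in> coalg_hom C X (cofree C A)" and n: "n \<in> coalg_hom C X (cofree C A)"
    and eq: "\<And>x. x \<in> carrier (fst X) \<Longrightarrow> counit C A (m x) = counit C A (n x)"
  shows "m = n"
proof -
  have "compose (carrier (fst X)) (counit C A) m = compose (carrier (fst X)) (counit C A) n"
    using eq by (simp add: compose_eq_iff)
  then show ?thesis using transpose_counit[OF X A m] transpose_counit[OF X A n] by metis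
qed

section \<open>Subcoalgebras\<close>

abbreviation incl where "incl A S \<equiv> Map C (substruct A S) A (ident (substruct A S))"

text \<open>The last condition says that the structure map, restricted to \<open>S\<close>, factors
  through \<open>C\<close> of the substructure on \<open>S\<close>. The factorization is unique,
  because \<open>C\<close> turns the inclusion into an embedding.\<close>

definition sub_closed :: "('s, 'u) coalg \<Rightarrow> 'u set \<Rightarrow> bool" where
  "sub_closed X S \<longleftrightarrow> S \<subseteq> carrier (fst X) \<and> set_option (pt (fst X)) \<subseteq> S \<and>
     snd X ` S \<subseteq> incl (fst X) S ` carrier (Ob C (substruct (fst X) S))"

text \<open>If \<open>sub_closed X S\<close> holds, \<open>inv_into\<close> has exactly one preimage
  to choose, \<open>incl\<close> being injective.\<close>

definition subcoalg :: "('s, 'u) coalg \<Rightarrow> 'u set \<Rightarrow> ('s, 'u) coalg" where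
  "subcoalg X S =
     (substruct (fst X) S,
      restrict (\<lambda>x. inv_into (carrier (Ob C (substruct (fst X) S))) (incl (fst X) S) (snd X x)) S)"

lemma fst_subcoalg [simp]: "fst (subcoalg X S) = substruct (fst X) S"
  by (simp add: subcoalg_def)

lemma substruct_K:
  assumes "A \<in> K" "S \<subseteq> carrier A" "set_option (pt A) \<subseteq> S"
  shows "substruct A S \<in> K"
  using assms universe by (auto simp: structs_def set_universe_def split: if_splits)

lemma sub_closed_K: "X \<in> EM K C \<Longrightarrow> sub_closed X S \<Longrightarrow> substruct (fst X) S \<in> K"
  unfolding sub_closed_def by (blast intro: substruct_K EM_K)

lemma sub_closed_incl:
  "X \<in> EM K C \<Longrightarrow> sub_closed X S \<Longrightarrow>
   embedding (substruct (fst X) S) (fst X) (ident (substruct (fst X) S))"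
  unfolding sub_closed_def by (blast intro: embedding_incl EM_K)

lemma incl_snd_subcoalg:
  assumes "sub_closed X S" "x \<in> S"
  shows "incl (fst X) S (snd (subcoalg X S) x) = snd X x"
    and "snd (subcoalg X S) x \<in> carrier (Ob C (substruct (fst X) S))"
proof -
  have "snd X x \<in> incl (fst X) S ` carrier (Ob C (substruct (fst X) S))"
    using assms by (auto simp: sub_closed_def)
  then show "incl (fst X) S (snd (subcoalg X S) x) = snd X x"
    "snd (subcoalg X S) x \<in> carrier (Ob C (substruct (fst X) S))"
    using assms(2) by (auto simp: subcoalg_def f_inv_into_f inv_into_into)
qed

text \<open>All laws are checked after applying \<open>C\<close> (or \<open>C C\<close>) of the inclusion, which is injective
  and reflects relations because \<open>C\<close> preserves embeddings.\<close>

lemma subcoalg_EM: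
  assumes X: "X \<in> EM K C" and S: "sub_closed X S"
  shows "subcoalg X S \<in> EM K C"
proof -
  define A \<alpha> B \<beta> i where "A = fst X" and "\<alpha> = snd X" and "B = substruct A S"
    and "\<beta> = snd (subcoalg X S)" and "i = ident B"
  note defs = A_def \<alpha>_def B_def \<beta>_def i_def
  have A: "A \<in> K" and B: "B \<in> K" and i: "embedding B A i" and \<alpha>: "\<alpha> \<in> hom A (Ob C A)"
    using EM_K[OF X] sub_closed_K[OF X S] sub_closed_incl[OF X S] EM_hom[OF X]
    by (simp_all add: defs)
  note CA = Ob_closed[OF A] and CB = Ob_closed[OF B]
  note ih = embeddingD_hom[OF i]
  have cB [simp]: "carrier B = S" by (simp add: defs)
  have SA: "x \<in> carrier A" if "x \<in> S" for x using S that by (auto simp: sub_closed_def defs)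
  have ix: "i x = x" if "x \<in> S" for x using that by (simp add: defs)
  have \<beta>: "Map C B A i (\<beta> x) = \<alpha> x" "\<beta> x \<in> carrier (Ob C B)" if "x \<in> S" for x
    using incl_snd_subcoalg[OF S that] by (simp_all add: defs)
  have Ci: "embedding (Ob C B) (Ob C A) (Map C B A i)" by (rule Map_embedding[OF B A i])
  have eq: "compose (carrier B) (Map C B A i) \<beta> = compose (carrier B) \<alpha> i"
    using \<beta> ix by (auto simp: compose_def)
  have \<beta>h: "\<beta> \<in> hom B (Ob C B)"
  proof (rule hom_of_compose_embedding[OF B CB _ _ Ci])
    show "compose (carrier B) (Map C B A i) \<beta> \<in> hom B (Ob C A)"
      unfolding eq by (rule hom_compose[OF B ih \<alpha>])
  qed (use \<beta> in \<open>auto simp: \<beta>_def subcoalg_def\<close>)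
  have "counit C B (\<beta> x) = x" if x: "x \<in> S" for x
  proof -
    have "i (counit C B (\<beta> x)) = counit C A (\<alpha> x)"
      using counit_natural_apply[OF B A ih \<beta>(2)[OF x]] \<beta>(1)[OF x] by simp
    also have "\<dots> = x" using EM_counit[OF X] SA[OF x] by (simp add: defs)
    finally show ?thesis
      using ix hom_carrier[OF counit_hom[OF B] \<beta>(2)[OF x]] by simp
  qed
  moreover have "comult C B (\<beta> x) = Map C B (Ob C B) \<beta> (\<beta> x)" if x: "x \<in> S" for x
  proof (rule embeddingD_inj[OF Map_embedding[OF CB CA Ci]])
    \<comment> \<open>Naturality of the comultiplication leads from \<open>B\<close> to
      \<open>A\<close>, where the law of \<open>X\<close> applies. Functoriality along the equation
      \<open>eq\<close> leads back.\<close>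
    have "Map C (Ob C B) (Ob C A) (Map C B A i) (comult C B (\<beta> x)) = comult C A (\<alpha> x)"
      using comult_natural_apply[OF B A ih \<beta>(2)[OF x]] \<beta>(1)[OF x] by simp
    also have "\<dots> = Map C A (Ob C A) \<alpha> (\<alpha> x)"
      using EM_comult[OF X] SA[OF x] by (simp add: defs)
    also have "\<dots> = Map C B (Ob C A) (compose (carrier B) \<alpha> i) (\<beta> x)"
      using Map_compose_apply[OF B A CA ih \<alpha> \<beta>(2)[OF x]] \<beta>(1)[OF x] by simp
    also have "\<dots> = Map C (Ob C B) (Ob C A) (Map C B A i) (Map C B (Ob C B) \<beta> (\<beta> x))"
      using Map_compose_apply[OF B CB CA \<beta>h embeddingD_hom[OF Ci] \<beta>(2)[OF x]] eq by simp
    finally show "Map C (Ob C B) (Ob C A) (Map C B A i) (comult C B (\<beta> x)) =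
        Map C (Ob C B) (Ob C A) (Map C B A i) (Map C B (Ob C B) \<beta> (\<beta> x))" .
    show "comult C B (\<beta> x) \<in> carrier (Ob C (Ob C B))"
      by (rule hom_carrier[OF comult_hom[OF B] \<beta>(2)[OF x]])
    show "Map C B (Ob C B) \<beta> (\<beta> x) \<in> carrier (Ob C (Ob C B))"
      by (rule hom_carrier[OF Map_hom[OF B CB \<beta>h] \<beta>(2)[OF x]])
  qed
  ultimately have "(B, \<beta>) \<in> EM K C" using B \<beta>h by (simp add: EM_iff)
  moreover have "(B, \<beta>) = subcoalg X S" by (simp add: defs subcoalg_def)
  ultimately show ?thesis by simp
qed

lemma ident_coalg_hom_subcoalg:
  assumes X: "X \<in> EM K C" and S: "sub_closed X S"
  shows "ident (substruct (fst X) S) \<in> coalg_hom C (subcoalg X S) X"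
  using embeddingD_hom[OF sub_closed_incl[OF X S]] incl_snd_subcoalg(1)[OF S]
  by (simp add: coalg_hom_iff)

text \<open>After the injective map \<open>incl\<close>, the equation for the corestriction becomes
  the one that \<open>f\<close> satisfies as a morphism into \<open>X\<close>.\<close>

lemma coalg_hom_subcoalgI:
  assumes W: "W \<in> EM K C" and X: "X \<in> EM K C" and S: "sub_closed X S"
    and f: "f \<in> coalg_hom C W X" and im: "f ` carrier (fst W) \<subseteq> S"
  shows "f \<in> coalg_hom C W (subcoalg X S)"
proof -
  let ?B = "substruct (fst X) S"
  note B = sub_closed_K[OF X S] and i = sub_closed_incl[OF X S]
  have fB: "f \<in> hom (fst W) ?B"
    by (rule hom_substructI[OF coalg_hom_hom[OF f] EM_K[OF W] im])
  have "Map C (fst W) ?B f (snd W x) = snd (subcoalg X S) (f x)" if x: "x \<in> carrier (fst W)" for x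
  proof (rule embeddingD_inj[OF Map_embedding[OF B EM_K[OF X] i]])
    have fx: "f x \<in> S" using im x by auto
    have w: "snd W x \<in> carrier (Ob C (fst W))" by (rule hom_carrier[OF EM_hom[OF W] x])
    have "incl (fst X) S (Map C (fst W) ?B f (snd W x)) = Map C (fst W) (fst X) f (snd W x)"
      using Map_compose_apply[OF EM_K[OF W] B EM_K[OF X] fB embeddingD_hom[OF i] w]
        compose_incl[OF hom_extensional[OF fB] im] by simp
    then show "incl (fst X) S (Map C (fst W) ?B f (snd W x)) = incl (fst X) S (snd (subcoalg X S) (f x))"
      using f x incl_snd_subcoalg(1)[OF S fx] by (simp add: coalg_hom_iff)
    show "Map C (fst W) ?B f (snd W x) \<in> carrier (Ob C ?B)"
      by (rule hom_carrier[OF Map_hom[OF EM_K[OF W] B fB] w])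
    show "snd (subcoalg X S) (f x) \<in> carrier (Ob C ?B)"
      by (rule incl_snd_subcoalg(2)[OF S fx])
  qed
  then show ?thesis using fB by (simp add: coalg_hom_iff)
qed

lemma coalg_hom_subcoalgD:
  assumes W: "W \<in> EM K C" and X: "X \<in> EM K C" and S: "sub_closed X S"
    and f: "f \<in> coalg_hom C W (subcoalg X S)"
  shows "f \<in> coalg_hom C W X"
proof -
  have "f ` carrier (fst W) \<subseteq> S" using hom_carrier[OF coalg_hom_hom[OF f]] by auto
  then show ?thesis
    using coalg_hom_compose[OF W subcoalg_EM[OF X S] X f ident_coalg_hom_subcoalg[OF X S]]
      compose_incl[OF hom_extensional[OF coalg_hom_hom[OF f]], of S "fst X"] by simp
qed

lemma embedding_subcoalgD:
  assumes W: "W \<in> EM K C" and X: "X \<in> EM K C" and S: "sub_closed X S"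
    and f: "embedding (fst W) (fst (subcoalg X S)) f"
  shows "embedding (fst W) (fst X) f"
proof -
  have f': "embedding (fst W) (substruct (fst X) S) f" using f by simp
  have "f ` carrier (fst W) \<subseteq> S" using hom_carrier[OF embeddingD_hom[OF f']] by auto
  then show ?thesis
    using embedding_compose[OF EM_K[OF W] f' sub_closed_incl[OF X S]]
      compose_incl[OF hom_extensional[OF embeddingD_hom[OF f]], of S "fst X"] by simp
qed

text \<open>The structure map of \<open>X\<close> at \<open>f x\<close> is the image under
  \<open>C f\<close> of the structure map of \<open>W\<close> at \<open>x\<close>. As
  \<open>f\<close> factors through its image, \<open>C f\<close> factors through \<open>C\<close> of
  that image.\<close>

lemma sub_closed_image:
  assumes W: "W \<in> EM K C" and X: "X \<in> EM K C" and f: "f \<in> coalg_hom C W X"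
  shows "sub_closed X (f ` carrier (fst W))"
proof -
  let ?S = "f ` carrier (fst W)"
  let ?B = "substruct (fst X) ?S"
  note fh = coalg_hom_hom[OF f]
  have S: "?S \<subseteq> carrier (fst X)" using hom_carrier[OF fh] by auto
  have p: "set_option (pt (fst X)) \<subseteq> ?S"
    using hom_pt[OF fh] structsD_pt[OF EM_K[OF W]] by (cases "pt (fst W)") auto
  note B = substruct_K[OF EM_K[OF X] S p] and i = embeddingD_hom[OF embedding_incl[OF EM_K[OF X] S p]]
  have fB: "f \<in> hom (fst W) ?B" by (rule hom_substructI[OF fh EM_K[OF W]]) simp
  have "snd X (f x) \<in> incl (fst X) ?S ` carrier (Ob C ?B)" if x: "x \<in> carrier (fst W)" for x
  proof (rule image_eqI)
    have w: "snd W x \<in> carrier (Ob C (fst W))" by (rule hom_carrier[OF EM_hom[OF W] x])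
    show "Map C (fst W) ?B f (snd W x) \<in> carrier (Ob C ?B)"
      by (rule hom_carrier[OF Map_hom[OF EM_K[OF W] B fB] w])
    show "snd X (f x) = incl (fst X) ?S (Map C (fst W) ?B f (snd W x))"
      using Map_compose_apply[OF EM_K[OF W] B EM_K[OF X] fB i w]
        compose_incl[OF hom_extensional[OF fB] order_refl] f x by (simp add: coalg_hom_iff)
  qed
  then show ?thesis using S p by (auto simp: sub_closed_def)
qed

text \<open>The inclusion of \<open>S\<close> factors through that of \<open>T\<close>, and
  \<open>C\<close> preserves the factorization. This is what makes unions of
  \<open>sub_closed\<close> sets \<open>sub_closed\<close>.\<close>

lemma incl_image_mono:
  assumes A: "A \<in> K" and ST: "S \<subseteq> T" "T \<subseteq> carrier A" and p: "set_option (pt A) \<subseteq> S"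
  shows "incl A S ` carrier (Ob C (substruct A S)) \<subseteq> incl A T ` carrier (Ob C (substruct A T))"
proof -
  let ?j = "ident (substruct A S)"
  have S: "substruct A S \<in> K" and T: "substruct A T \<in> K"
    by (rule substruct_K[OF A]; use ST p in blast)+
  have jA: "?j \<in> hom (substruct A S) A" and iT: "ident (substruct A T) \<in> hom (substruct A T) A"
    by (rule embeddingD_hom[OF embedding_incl[OF A]]; use ST p in blast)+
  have j: "?j \<in> hom (substruct A S) (substruct A T)"
    by (rule hom_substructI[OF jA S]) (use ST in auto)
  have "compose (carrier (substruct A S)) (ident (substruct A T)) ?j = ?j"
    by (rule extensionalityI[of _ S]) (use ST in \<open>auto simp: compose_eq\<close>)
  then have "incl A S z = incl A T (Map C (substruct A S) (substruct A T) ?j z)"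
    if "z \<in> carrier (Ob C (substruct A S))" for z
    using Map_compose_apply[OF S T A j iT that] by simp
  then show ?thesis using hom_carrier[OF Map_hom[OF S T j]] by auto
qed

section \<open>The largest subcoalgebra inside a subset\<close>

definition largest_sub :: "('s, 'u) coalg \<Rightarrow> 'u set \<Rightarrow> 'u set" where
  "largest_sub X T = \<Union>{S. S \<subseteq> T \<and> sub_closed X S}"

lemma largest_sub_upper: "S \<subseteq> T \<Longrightarrow> sub_closed X S \<Longrightarrow> S \<subseteq> largest_sub X T"
  by (auto simp: largest_sub_def)

text \<open>Guarantees that the union in \<open>largest_sub\<close> contains the point; for plain
  structures the set is empty.\<close>

lemma sub_closed_point:
  assumes X: "X \<in> EM K C"
  shows "sub_closed X (set_option (pt (fst X)))"
proof -
  let ?S = "set_option (pt (fst X))"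
  have S: "?S \<subseteq> carrier (fst X)" using structsD_pt[OF EM_K[OF X]] by auto
  note B = substruct_K[OF EM_K[OF X] S order_refl]
  note i = embeddingD_hom[OF embedding_incl[OF EM_K[OF X] S order_refl]]
  have "snd X x \<in> incl (fst X) ?S ` carrier (Ob C (substruct (fst X) ?S))" if x: "pt (fst X) = Some x" for x
  proof -
    \<comment> \<open>The structure map and \<open>incl\<close> both preserve points, so the point
      \<open>y\<close> of \<open>C\<close> of the one-point substructure is the required
      preimage.\<close>
    obtain y where y: "pt (Ob C (substruct (fst X) ?S)) = Some y"
      using structs_pt_None_iff[OF Ob_closed[OF B]] structs_pt_None_iff[OF EM_K[OF X]] x by auto
    have "snd X x = incl (fst X) ?S y"
      using hom_pt[OF EM_hom[OF X]] hom_pt[OF Map_hom[OF B EM_K[OF X] i]] x y by simp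
    then show ?thesis using structsD_pt[OF Ob_closed[OF B] y] by blast
  qed
  then show ?thesis using S by (auto simp: sub_closed_def)
qed

text \<open>Each element lies in some \<open>sub_closed\<close> member \<open>S\<close> of the
  union, and the factorization through \<open>C\<close> of \<open>S\<close> passes to the union by
  \<open>incl_image_mono\<close>.\<close>

lemma sub_closed_largest_sub:
  assumes X: "X \<in> EM K C" and p: "set_option (pt (fst X)) \<subseteq> T"
  shows "sub_closed X (largest_sub X T)"
proof -
  let ?E = "largest_sub X T"
  have E: "?E \<subseteq> carrier (fst X)" by (auto simp: largest_sub_def sub_closed_def)
  have "set_option (pt (fst X)) \<subseteq> ?E"
    using sub_closed_point[OF X] p by (auto simp: largest_sub_def)
  moreover have "snd X x \<in> incl (fst X) ?E ` carrier (Ob C (substruct (fst X) ?E))" if x: "x \<in> ?E" for x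
  proof -
    obtain S where S: "x \<in> S" "S \<subseteq> T" "sub_closed X S" using x by (auto simp: largest_sub_def)
    then have "S \<subseteq> ?E" by (auto simp: largest_sub_def)
    then have "incl (fst X) S ` carrier (Ob C (substruct (fst X) S)) \<subseteq>
        incl (fst X) ?E ` carrier (Ob C (substruct (fst X) ?E))"
      by (rule incl_image_mono[OF EM_K[OF X] _ E]) (use S(3) in \<open>simp add: sub_closed_def\<close>)
    moreover have "snd X x \<in> incl (fst X) S ` carrier (Ob C (substruct (fst X) S))"
      using S(1,3) unfolding sub_closed_def by (meson image_subset_iff)
    ultimately show ?thesis by (rule subsetD)
  qed
  ultimately show ?thesis using E by (auto simp: sub_closed_def)
qed

section \<open>Products of coalgebras\<close>

text \<open>Besides the existence of mediating arrows, the last two conjuncts tie \<open>Z\<close>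
  to the cofree coalgebra on the product of structures: an arrow into \<open>Z\<close> is the
  transpose of the pair of its components, hence determined by them, and an embedding into
  \<open>Z\<close> is also one into the cofree coalgebra.\<close>

definition concrete_product ::
  "('s, 'u) coalg \<Rightarrow> ('s, 'u) coalg \<Rightarrow> ('s, 'u) coalg \<Rightarrow> ('u \<Rightarrow> 'u) \<Rightarrow> ('u \<Rightarrow> 'u) \<Rightarrow> bool" where
  "concrete_product X Y Z p q \<longleftrightarrow>
     Z \<in> EM K C \<and> p \<in> coalg_hom C Z X \<and> q \<in> coalg_hom C Z Y \<and>
     (\<forall>W\<in>EM K C. \<forall>f\<in>coalg_hom C W X. \<forall>g\<in>coalg_hom C W Y. \<exists>d\<in>coalg_hom C W Z.
        compose (carrier (fst W)) p d = f \<and> compose (carrier (fst W)) q d = g) \<and>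
     (\<forall>W\<in>EM K C. \<forall>e\<in>coalg_hom C W Z.
        e = transpose W (struct_prod pr (fst X) (fst Y))
          (pair pr (fst W) (compose (carrier (fst W)) p e) (compose (carrier (fst W)) q e))) \<and>
     (\<forall>W\<in>EM K C. \<forall>e. embedding (fst W) (fst Z) e \<longrightarrow>
        embedding (fst W) (Ob C (struct_prod pr (fst X) (fst Y))) e)"

text \<open>The product is carved out of the cofree coalgebra on the product of the underlying
  structures: it is the largest subcoalgebra on which both projections are coalgebra morphisms.
  In particular arrows into it are, as functions, arrows into the cofree coalgebra.\<close>

lemma ex_concrete_product:
  assumes X: "X \<in> EM K C" and Y: "Y \<in> EM K C"
  shows "\<exists>Z p q. concrete_product X Y Z p q"
proof -
  define A B where "A = fst X" and "B = fst Y"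
  define P where "P = struct_prod pr A B"
  define \<pi>1 \<pi>2 where "\<pi>1 = proj1 pr A B" and "\<pi>2 = proj2 pr A B"
  have A: "A \<in> K" and B: "B \<in> K" and P: "P \<in> K"
    using EM_K[OF X] EM_K[OF Y] by (auto simp: A_def B_def P_def prod_K)
  have \<pi>1: "\<pi>1 \<in> hom P A" and \<pi>2: "\<pi>2 \<in> hom P B"
    using proj_hom[OF inj_pr A B] by (simp_all add: \<pi>1_def \<pi>2_def P_def)
  have \<alpha>: "snd X \<in> hom A (Ob C A)" and \<beta>: "snd Y \<in> hom B (Ob C B)"
    using EM_hom[OF X] EM_hom[OF Y] by (simp_all add: A_def B_def)
  note CP = Ob_closed[OF P]
  note F = cofree_EM[OF P]
  \<comment> \<open>\<open>T\<close> is the set where two maps out of \<open>Ob C P\<close> agree,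
    for each projection: apply the counit, project and use the structure map, or apply
    \<open>C\<close> of the projection. As shown in \<open>proj_coalg\<close>, this is the morphism
    equation for the projections of \<open>Z\<close>.\<close>
  define T where "T = {z \<in> carrier (Ob C P). snd X (\<pi>1 (counit C P z)) = Map C P A \<pi>1 z \<and>
    snd Y (\<pi>2 (counit C P z)) = Map C P B \<pi>2 z}"
  define E where "E = largest_sub (cofree C P) T"
  have "set_option (pt (Ob C P)) \<subseteq> T"
  proof
    fix z assume z: "z \<in> set_option (pt (Ob C P))"
    have "pt P = Some (counit C P z)" using hom_pt[OF counit_hom[OF P]] z by auto
    then have "pt A = Some (\<pi>1 (counit C P z))" "pt B = Some (\<pi>2 (counit C P z))"
      using hom_pt[OF \<pi>1] hom_pt[OF \<pi>2] by auto
    then have "pt (Ob C A) = Some (snd X (\<pi>1 (counit C P z)))"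
      "pt (Ob C B) = Some (snd Y (\<pi>2 (counit C P z)))"
      using hom_pt[OF \<alpha>] hom_pt[OF \<beta>] by auto
    moreover have "pt (Ob C A) = Some (Map C P A \<pi>1 z)" "pt (Ob C B) = Some (Map C P B \<pi>2 z)"
      using z hom_pt[OF Map_hom[OF P A \<pi>1]] hom_pt[OF Map_hom[OF P B \<pi>2]] by auto
    ultimately show "z \<in> T"
      using z structsD_pt[OF CP] by (auto simp: T_def)
  qed
  then have E: "sub_closed (cofree C P) E"
    using sub_closed_largest_sub[OF F] by (simp add: E_def)
  have ET: "E \<subseteq> T" by (auto simp: E_def largest_sub_def)
  define Z where "Z = subcoalg (cofree C P) E"
  have Z: "Z \<in> EM K C" using subcoalg_EM[OF F E] by (simp add: Z_def)
  have cZ: "carrier (fst Z) = E" by (simp add: Z_def)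
  have inclF: "ident (fst Z) \<in> coalg_hom C Z (cofree C P)"
    using ident_coalg_hom_subcoalg[OF F E] by (simp add: Z_def)
  \<comment> \<open>Treats both projections at once, with \<rho> standing for \<open>\<pi>1\<close>
    or \<open>\<pi>2\<close>. The inclusion of \<open>Z\<close> turns its structure map into the
    comultiplication, which \<open>C\<close> of the counit cancels, leaving the right-hand side of
    \<open>eq\<close>.\<close>
  have proj_coalg: "compose E (compose (carrier (Ob C P)) \<rho> (counit C P)) (ident (fst Z)) \<in> coalg_hom C Z V"
    if V: "V \<in> EM K C" and \<rho>: "\<rho> \<in> hom P (fst V)"
      and eq: "\<And>z. z \<in> E \<Longrightarrow> snd V (\<rho> (counit C P z)) = Map C P (fst V) \<rho> z" for V \<rho>
  proof -
    let ?u = "compose (carrier (Ob C P)) \<rho> (counit C P)"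
    define r where "r = compose E ?u (ident (fst Z))"
    have u: "?u \<in> hom (Ob C P) (fst V)" by (rule hom_compose[OF CP counit_hom[OF P] \<rho>])
    have r: "r \<in> hom (fst Z) (fst V)"
      using hom_compose[OF EM_K[OF Z] coalg_hom_hom[OF inclF]] u by (simp add: cZ r_def)
    have "Map C (fst Z) (fst V) r (snd Z z) = snd V (r z)" if z: "z \<in> E" for z
    proof -
      have zP: "z \<in> carrier (Ob C P)" using z ET by (auto simp: T_def)
      have s: "snd Z z \<in> carrier (Ob C (fst Z))"
        using hom_carrier[OF EM_hom[OF Z]] z by (simp add: cZ)
      have "Map C (fst Z) (fst V) r (snd Z z) =
          Map C (Ob C P) (fst V) ?u (Map C (fst Z) (Ob C P) (ident (fst Z)) (snd Z z))"
        using Map_compose_apply[OF EM_K[OF Z] CP EM_K[OF V] _ u s] coalg_hom_hom[OF inclF]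
        by (simp add: cZ r_def)
      also have "Map C (fst Z) (Ob C P) (ident (fst Z)) (snd Z z) = comult C P z"
        using inclF z by (simp add: coalg_hom_iff cZ)
      also have "Map C (Ob C P) (fst V) ?u (comult C P z) =
          Map C P (fst V) \<rho> (Map C (Ob C P) P (counit C P) (comult C P z))"
        using Map_compose_apply[OF CP P EM_K[OF V] counit_hom[OF P] \<rho>]
          hom_carrier[OF comult_hom[OF P] zP] by simp
      also have "Map C (Ob C P) P (counit C P) (comult C P z) = z"
        using fun_cong[OF Map_counit_comult[OF P], of z] zP by (simp add: compose_eq)
      finally show ?thesis using eq[OF z] z zP by (simp add: r_def compose_eq cZ)
    qed
    then have "r \<in> coalg_hom C Z V" using r by (simp add: coalg_hom_iff cZ)
    then show ?thesis unfolding r_def .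
  qed
  define p where "p = compose E (compose (carrier (Ob C P)) \<pi>1 (counit C P)) (ident (fst Z))"
  define q where "q = compose E (compose (carrier (Ob C P)) \<pi>2 (counit C P)) (ident (fst Z))"
  have EP: "z \<in> carrier (Ob C P)" if "z \<in> E" for z using that ET by (auto simp: T_def)
  have pz: "p z = \<pi>1 (counit C P z)" and qz: "q z = \<pi>2 (counit C P z)" if "z \<in> E" for z
    using that EP[OF that] by (simp_all add: p_def q_def compose_eq cZ)
  have p: "p \<in> coalg_hom C Z X"
    unfolding p_def by (rule proj_coalg[OF X]) (use \<pi>1 ET in \<open>auto simp: T_def A_def\<close>)
  have q: "q \<in> coalg_hom C Z Y"
    unfolding q_def by (rule proj_coalg[OF Y]) (use \<pi>2 ET in \<open>auto simp: T_def B_def\<close>)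
  have univ: "\<exists>d\<in>coalg_hom C W Z. compose (carrier (fst W)) p d = f \<and> compose (carrier (fst W)) q d = g"
    if W: "W \<in> EM K C" and f: "f \<in> coalg_hom C W X" and g: "g \<in> coalg_hom C W Y" for W f g
  proof -
    let ?h = "pair pr (fst W) f g"
    have fh: "f \<in> hom (fst W) A" and gh: "g \<in> hom (fst W) B"
      using coalg_hom_hom[OF f] coalg_hom_hom[OF g] by (simp_all add: A_def B_def)
    have h: "?h \<in> hom (fst W) P" unfolding P_def by (rule pair_hom[OF EM_K[OF W] fh gh])
    have \<pi>h: "compose (carrier (fst W)) \<pi>1 ?h = f" "compose (carrier (fst W)) \<pi>2 ?h = g"
      using hom_extensional[OF fh] hom_extensional[OF gh] proj_pair[OF inj_pr fh gh]
      by (auto intro!: extensionalityI[of _ "carrier (fst W)"] simp: compose_eq \<pi>1_def \<pi>2_def)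
    \<comment> \<open>The mediating arrow is the transpose of the pair. Its values lie in
      \<open>T\<close> exactly because \<open>f\<close> and \<open>g\<close> are coalgebra
      morphisms.\<close>
    define d where "d = transpose W P ?h"
    have d: "d \<in> coalg_hom C W (cofree C P)" unfolding d_def by (rule transpose_coalg_hom[OF W P h])
    have cd: "\<pi>1 (counit C P (d x)) = f x" "\<pi>2 (counit C P (d x)) = g x" if "x \<in> carrier (fst W)" for x
      using counit_transpose[OF W P h that] proj_pair[OF inj_pr fh gh that]
      by (simp_all add: d_def \<pi>1_def \<pi>2_def)
    have "d x \<in> T" if x: "x \<in> carrier (fst W)" for x
    proof -
      have w: "snd W x \<in> carrier (Ob C (fst W))" by (rule hom_carrier[OF EM_hom[OF W] x])
      have "Map C P A \<pi>1 (d x) = Map C (fst W) A f (snd W x)"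
        "Map C P B \<pi>2 (d x) = Map C (fst W) B g (snd W x)"
        using Map_compose_apply[OF EM_K[OF W] P A h \<pi>1 w] Map_compose_apply[OF EM_K[OF W] P B h \<pi>2 w]
          \<pi>h x by (simp_all add: d_def transpose_def compose_eq)
      then show ?thesis
        using f g cd[OF x] hom_carrier[OF coalg_hom_hom[OF d] x] x
        by (simp add: T_def coalg_hom_iff A_def B_def)
    qed
    \<comment> \<open>The image of \<open>d\<close> is \<open>sub_closed\<close> and contained in
      \<open>T\<close>, hence contained in the largest such set.\<close>
    then have im: "d ` carrier (fst W) \<subseteq> E"
      using largest_sub_upper[OF _ sub_closed_image[OF W F d]] by (auto simp: E_def)
    have "d \<in> coalg_hom C W Z"
      unfolding Z_def by (rule coalg_hom_subcoalgI[OF W F E d im])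
    moreover have "compose (carrier (fst W)) p d = f" "compose (carrier (fst W)) q d = g"
      using hom_extensional[OF fh] hom_extensional[OF gh] cd pz qz im
      by (auto intro!: extensionalityI[of _ "carrier (fst W)"] simp: compose_eq image_subset_iff)
    ultimately show ?thesis by blast
  qed
  have tr: "e = transpose W P
         (pair pr (fst W) (compose (carrier (fst W)) p e) (compose (carrier (fst W)) q e))"
    if W: "W \<in> EM K C" and e: "e \<in> coalg_hom C W Z" for W e
  proof -
    have eF: "e \<in> coalg_hom C W (cofree C P)"
      using coalg_hom_subcoalgD[OF W F E] e by (simp add: Z_def)
    have im: "e x \<in> E" if "x \<in> carrier (fst W)" for x
      using hom_carrier[OF coalg_hom_hom[OF e] that] by (simp add: cZ)
    \<comment> \<open>An element of \<open>P\<close> is the pair of its projections, so the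
      components of \<open>e\<close> pair up to the counit after \<open>e\<close>, whose transpose
      is \<open>e\<close>.\<close>
    have "pair pr (fst W) (compose (carrier (fst W)) p e) (compose (carrier (fst W)) q e) =
        compose (carrier (fst W)) (counit C P) e"
    proof (rule extensionalityI[of _ "carrier (fst W)"])
      fix x assume x: "x \<in> carrier (fst W)"
      have "counit C P (e x) \<in> carrier P"
        by (rule hom_carrier[OF counit_hom[OF P] EP[OF im[OF x]]])
      then show "pair pr (fst W) (compose (carrier (fst W)) p e) (compose (carrier (fst W)) q e) x =
          compose (carrier (fst W)) (counit C P) e x"
        using x pz qz im pr_proj[OF inj_pr]
        by (simp add: pair_def compose_eq \<pi>1_def \<pi>2_def P_def)
    qed (auto simp: pair_def)
    then show ?thesis using transpose_counit[OF W P eF] by simp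
  qed
  have "embedding (fst W) (Ob C P) e" if W: "W \<in> EM K C" and e: "embedding (fst W) (fst Z) e" for W e
    using embedding_subcoalgD[OF W F E] e by (simp add: Z_def)
  then have "concrete_product X Y Z p q"
    unfolding concrete_product_def A_def[symmetric] B_def[symmetric] P_def[symmetric]
    using Z p q univ tr by blast
  then show ?thesis by blast
qed

section \<open>Cofree coalgebras on products\<close>

definition cofree_pair ::
  "('s, 'u) coalg \<Rightarrow> ('s, 'u) rel_struct \<Rightarrow> ('s, 'u) rel_struct \<Rightarrow> ('u \<Rightarrow> 'u) \<Rightarrow> ('u \<Rightarrow> 'u) \<Rightarrow> 'u \<Rightarrow> 'u" where
  "cofree_pair W A B u v = transpose W (struct_prod pr A B)
     (pair pr (fst W) (compose (carrier (fst W)) (counit C A) u) (compose (carrier (fst W)) (counit C B) v))"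

abbreviation Map_proj1 where "Map_proj1 A B \<equiv> Map C (struct_prod pr A B) A (proj1 pr A B)"
abbreviation Map_proj2 where "Map_proj2 A B \<equiv> Map C (struct_prod pr A B) B (proj2 pr A B)"

lemma Map_proj_coalg_hom:
  assumes A: "A \<in> K" and B: "B \<in> K"
  shows "Map_proj1 A B \<in> coalg_hom C (cofree C (struct_prod pr A B)) (cofree C A)"
    and "Map_proj2 A B \<in> coalg_hom C (cofree C (struct_prod pr A B)) (cofree C B)"
  by (rule Map_coalg_hom[OF prod_K[OF A B] A proj_hom(1)[OF inj_pr A B]],
      rule Map_coalg_hom[OF prod_K[OF A B] B proj_hom(2)[OF inj_pr A B]])

text \<open>As a right adjoint, \<open>cofree\<close> preserves products: \<open>Map_proj1\<close>
  and \<open>Map_proj2\<close> are the projections, \<open>cofree_pair\<close> the pairing. Both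
  equations are checked after the counit, where naturality reduces them to
  \<open>proj_pair\<close>.\<close>

lemma cofree_pair:
  assumes W: "W \<in> EM K C" and A: "A \<in> K" and B: "B \<in> K"
    and u: "u \<in> coalg_hom C W (cofree C A)" and v: "v \<in> coalg_hom C W (cofree C B)"
  shows "cofree_pair W A B u v \<in> coalg_hom C W (cofree C (struct_prod pr A B))" (is "?h \<in> _")
    and "x \<in> carrier (fst W) \<Longrightarrow> Map_proj1 A B (cofree_pair W A B u v x) = u x"
    and "x \<in> carrier (fst W) \<Longrightarrow> Map_proj2 A B (cofree_pair W A B u v x) = v x"
proof -
  let ?P = "struct_prod pr A B"
  let ?u = "compose (carrier (fst W)) (counit C A) u" and ?v = "compose (carrier (fst W)) (counit C B) v"
  note P = prod_K[OF A B]
  have u': "?u \<in> hom (fst W) A" and v': "?v \<in> hom (fst W) B"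
    using hom_compose[OF EM_K[OF W]] coalg_hom_hom[OF u] coalg_hom_hom[OF v]
      counit_hom[OF A] counit_hom[OF B] by auto
  note uv = pair_hom[OF EM_K[OF W] u' v']
  show h: "?h \<in> coalg_hom C W (cofree C ?P)"
    unfolding cofree_pair_def by (rule transpose_coalg_hom[OF W P uv])
  have c: "counit C ?P (?h y) = pair pr (fst W) ?u ?v y" if "y \<in> carrier (fst W)" for y
    unfolding cofree_pair_def by (rule counit_transpose[OF W P uv that])
  have hy: "?h y \<in> carrier (Ob C ?P)" if "y \<in> carrier (fst W)" for y
    using hom_carrier[OF coalg_hom_hom[OF h] that] by simp
  note pm = Map_proj_coalg_hom[OF A B]
  have "compose (carrier (fst W)) (Map_proj1 A B) ?h = u"
  proof (rule cofree_hom_eqI[OF W A _ u])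
    show "compose (carrier (fst W)) (Map_proj1 A B) ?h \<in> coalg_hom C W (cofree C A)"
      by (rule coalg_hom_compose[OF W cofree_EM[OF P] cofree_EM[OF A] h pm(1)])
    fix y assume y: "y \<in> carrier (fst W)"
    show "counit C A (compose (carrier (fst W)) (Map_proj1 A B) ?h y) = counit C A (u y)"
      using counit_natural_apply[OF P A proj_hom(1)[OF inj_pr A B] hy[OF y]]
        proj_pair(1)[OF inj_pr u' v' y] c[OF y] y by (simp add: compose_eq)
  qed
  then show "x \<in> carrier (fst W) \<Longrightarrow> Map_proj1 A B (?h x) = u x" by (metis compose_eq)
  have "compose (carrier (fst W)) (Map_proj2 A B) ?h = v"
  proof (rule cofree_hom_eqI[OF W B _ v])
    show "compose (carrier (fst W)) (Map_proj2 A B) ?h \<in> coalg_hom C W (cofree C B)"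
      by (rule coalg_hom_compose[OF W cofree_EM[OF P] cofree_EM[OF B] h pm(2)])
    fix y assume y: "y \<in> carrier (fst W)"
    show "counit C B (compose (carrier (fst W)) (Map_proj2 A B) ?h y) = counit C B (v y)"
      using counit_natural_apply[OF P B proj_hom(2)[OF inj_pr A B] hy[OF y]]
        proj_pair(2)[OF inj_pr u' v' y] c[OF y] y by (simp add: compose_eq)
  qed
  then show "x \<in> carrier (fst W) \<Longrightarrow> Map_proj2 A B (?h x) = v x" by (metis compose_eq)
qed

text \<open>The uniqueness half of the same universal property: by naturality the counit after
  \<open>m\<close> and after \<open>n\<close> have equal projections, so they agree, and the counit
  determines both arrows.\<close>

lemma Map_proj_jointly_monic:
  assumes W: "W \<in> EM K C" and A: "A \<in> K" and B: "B \<in> K"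
    and m: "m \<in> coalg_hom C W (cofree C (struct_prod pr A B))"
    and n: "n \<in> coalg_hom C W (cofree C (struct_prod pr A B))"
    and eq: "\<And>x. x \<in> carrier (fst W) \<Longrightarrow> Map_proj1 A B (m x) = Map_proj1 A B (n x)"
      "\<And>x. x \<in> carrier (fst W) \<Longrightarrow> Map_proj2 A B (m x) = Map_proj2 A B (n x)"
  shows "m = n"
proof (rule cofree_hom_eqI[OF W prod_K[OF A B] m n])
  let ?P = "struct_prod pr A B"
  note P = prod_K[OF A B] and \<pi> = proj_hom[OF inj_pr A B]
  fix x assume x: "x \<in> carrier (fst W)"
  have mx: "m x \<in> carrier (Ob C ?P)" and nx: "n x \<in> carrier (Ob C ?P)"
    using hom_carrier[OF coalg_hom_hom[OF m] x] hom_carrier[OF coalg_hom_hom[OF n] x] by simp_all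
  have "proj1 pr A B (counit C ?P (m x)) = proj1 pr A B (counit C ?P (n x))"
    using counit_natural_apply[OF P A \<pi>(1)] mx nx eq(1)[OF x] by metis
  moreover have "proj2 pr A B (counit C ?P (m x)) = proj2 pr A B (counit C ?P (n x))"
    using counit_natural_apply[OF P B \<pi>(2)] mx nx eq(2)[OF x] by metis
  ultimately show "counit C ?P (m x) = counit C ?P (n x)"
    using pr_proj[OF inj_pr hom_carrier[OF counit_hom[OF P] mx]]
      pr_proj[OF inj_pr hom_carrier[OF counit_hom[OF P] nx]] by metis
qed

text \<open>The components \<open>k \<circ> r\<close> and \<open>l \<circ> s\<close> of \<open>m\<close> land in \<open>C A\<close> and \<open>C B\<close>, not in \<open>A\<close> and \<open>B\<close>, so
  \<open>m\<close> is first continued along \<open>C (A \<times> B) \<rightarrow> C (C A \<times> C B)\<close>, where it becomes \<open>C (k \<times> l)\<close> after an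
  embedding.\<close>

lemma embedding_cofree_prod:
  assumes W: "W \<in> EM K C" and A: "A \<in> K" and B: "B \<in> K"
    and m: "m \<in> coalg_hom C W (cofree C (struct_prod pr A B))"
    and D: "D \<in> K" and E: "E \<in> K" and r: "r \<in> hom (fst W) D" and s: "s \<in> hom (fst W) E"
    and k: "embedding D (Ob C A) k" and l: "embedding E (Ob C B) l"
    and m1: "compose (carrier (fst W)) (Map_proj1 A B) m = compose (carrier (fst W)) k r"
    and m2: "compose (carrier (fst W)) (Map_proj2 A B) m = compose (carrier (fst W)) l s"
    and rs: "embedding (fst W) (Ob C (struct_prod pr D E)) (transpose W (struct_prod pr D E) (pair pr (fst W) r s))"
  shows "embedding (fst W) (Ob C (struct_prod pr A B)) m"
proof -
  let ?P = "struct_prod pr A B" and ?R = "struct_prod pr D E"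
  let ?Q = "struct_prod pr (Ob C A) (Ob C B)"
  note P = prod_K[OF A B] and R = prod_K[OF D E] and Q = prod_K[OF Ob_closed[OF A] Ob_closed[OF B]]
  note CP = Ob_closed[OF P]
  let ?\<kappa> = "pair pr (Ob C ?P) (Map_proj1 A B) (Map_proj2 A B)"
  let ?kl = "prod_map pr D E k l"
  have \<kappa>: "?\<kappa> \<in> hom (Ob C ?P) ?Q"
    by (rule pair_hom[OF CP Map_hom[OF P A proj_hom(1)[OF inj_pr A B]]
          Map_hom[OF P B proj_hom(2)[OF inj_pr A B]]])
  note kl = embedding_prod_map[OF inj_pr D E R k l]
  note rs_hom = pair_hom[OF EM_K[OF W] r s]
  have mh: "m \<in> hom (fst W) (Ob C ?P)" using coalg_hom_hom[OF m] by simp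
  \<comment> \<open>The transpose of \<kappa> over the cofree coalgebra on
    \<open>?P\<close>.\<close>
  let ?g = "compose (carrier (Ob C ?P)) (Map C (Ob C ?P) ?Q ?\<kappa>) (comult C ?P)"
  have g: "?g \<in> hom (Ob C ?P) (Ob C ?Q)"
    by (rule hom_compose[OF CP comult_hom[OF P] Map_hom[OF CP Q \<kappa>]])
  have "compose (carrier (fst W)) ?\<kappa> m =
      pair pr (fst W) (compose (carrier (fst W)) (Map_proj1 A B) m) (compose (carrier (fst W)) (Map_proj2 A B) m)"
    using hom_carrier[OF mh]
    by (auto intro!: extensionalityI[of _ "carrier (fst W)"] simp: compose_eq pair_def)
  also have "\<dots> = compose (carrier (fst W)) ?kl (pair pr (fst W) r s)"
    unfolding m1 m2 prod_map_pair[OF inj_pr r s] ..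
  finally have \<kappa>m: "compose (carrier (fst W)) ?\<kappa> m = compose (carrier (fst W)) ?kl (pair pr (fst W) r s)" .
  \<comment> \<open>As \<open>m\<close> is a coalgebra morphism, \<open>?g\<close> after
    \<open>m\<close> is the transpose of \<kappa> after \<open>m\<close>. By
    \<open>\<kappa>m\<close> and functoriality, this is the transpose of the pair of
    \<open>r\<close> and \<open>s\<close>, followed by \<open>C\<close> of
    \<open>?kl\<close>.\<close>
  have "compose (carrier (fst W)) ?g m =
      compose (carrier (fst W)) (Map C ?R ?Q ?kl) (transpose W ?R (pair pr (fst W) r s))"
  proof (rule extensionalityI[of _ "carrier (fst W)"])
    fix x assume x: "x \<in> carrier (fst W)"
    have w: "snd W x \<in> carrier (Ob C (fst W))" by (rule hom_carrier[OF EM_hom[OF W] x])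
    have "?g (m x) = Map C (Ob C ?P) ?Q ?\<kappa> (Map C (fst W) (Ob C ?P) m (snd W x))"
      using m x hom_carrier[OF mh x] by (simp add: coalg_hom_iff compose_eq)
    also have "\<dots> = Map C (fst W) ?Q (compose (carrier (fst W)) ?kl (pair pr (fst W) r s)) (snd W x)"
      using Map_compose_apply[OF EM_K[OF W] CP Q mh \<kappa> w] \<kappa>m by simp
    also have "\<dots> = Map C ?R ?Q ?kl (Map C (fst W) ?R (pair pr (fst W) r s) (snd W x))"
      by (rule Map_compose_apply[OF EM_K[OF W] R Q rs_hom embeddingD_hom[OF kl] w])
    finally show "compose (carrier (fst W)) ?g m x =
        compose (carrier (fst W)) (Map C ?R ?Q ?kl) (transpose W ?R (pair pr (fst W) r s)) x"
      using x by (simp add: compose_eq transpose_def)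
  qed auto
  then have "embedding (fst W) (Ob C ?Q) (compose (carrier (fst W)) ?g m)"
    using embedding_compose[OF EM_K[OF W] rs Map_embedding[OF R Q kl]] by simp
  then show ?thesis by (rule embedding_of_compose[OF mh g])
qed

end

section \<open>Paths\<close>

locale path_comonad = embedding_comonad \<U> \<sigma> pointed C pr
  for \<U> :: "'u set set" and \<sigma> :: "'s signature" and pointed and C :: "('s, 'u) comonad" and pr +
  fixes Paths :: "('s, 'u) coalg set"
  assumes Paths_EM: "Paths \<subseteq> EM K C"
    and Paths_quotient:
      "\<lbrakk>X \<in> EM K C; Y \<in> EM K C; surjective_coalg_hom C X Y f; X \<in> Paths\<rbrakk> \<Longrightarrow> Y \<in> Paths"
begin

lemma path_EM: "P \<in> Paths \<Longrightarrow> P \<in> EM K C"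
  using Paths_EM by blast

lemma path_embeddingD:
  assumes "path_embedding C Paths P X e"
  shows "P \<in> Paths" "e \<in> coalg_hom C P X" "embedding (fst P) (fst X) e"
  using assms by (auto simp: path_embedding_def)

text \<open>Corestricted to its image, \<open>u\<close> is a surjective coalgebra morphism out of a
  path, so the image is a path by \<open>Paths_quotient\<close>.\<close>

lemma path_embedding_image:
  assumes P: "P \<in> Paths" and X: "X \<in> EM K C" and u: "u \<in> coalg_hom C P X"
  defines "S \<equiv> u ` carrier (fst P)"
  shows "path_embedding C Paths (subcoalg X S) X (ident (substruct (fst X) S))"
proof -
  have S: "sub_closed X S" unfolding S_def by (rule sub_closed_image[OF path_EM[OF P] X u])
  have "u \<in> coalg_hom C P (subcoalg X S)"
    by (rule coalg_hom_subcoalgI[OF path_EM[OF P] X S u]) (simp add: S_def)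
  then have "surjective_coalg_hom C P (subcoalg X S) u"
    by (simp add: surjective_coalg_hom_def S_def)
  then have "subcoalg X S \<in> Paths"
    by (rule Paths_quotient[OF path_EM[OF P] subcoalg_EM[OF X S] _ P])
  then show ?thesis
    using ident_coalg_hom_subcoalg[OF X S] sub_closed_incl[OF X S] by (simp add: path_embedding_def)
qed

text \<open>Both \<open>u\<close> and \<open>m\<close> are replaced by the inclusions of their images, which are again paths.\<close>

lemma open_morphism_lift:
  assumes X: "X \<in> EM K C" and Y: "Y \<in> EM K C" and f: "open_morphism C Paths X Y f"
    and P: "P \<in> Paths" and Q: "Q \<in> Paths"
    and u: "u \<in> coalg_hom C P X" and m: "m \<in> coalg_hom C Q Y" and g: "g \<in> coalg_hom C P Q"
    and comm: "\<And>x. x \<in> carrier (fst P) \<Longrightarrow> f (u x) = m (g x)"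
  shows "\<exists>d\<in>coalg_hom C Q X. compose (carrier (fst P)) d g = u \<and> compose (carrier (fst Q)) f d = m"
proof -
  define S T where "S = u ` carrier (fst P)" and "T = m ` carrier (fst Q)"
  have S: "sub_closed X S" and T: "sub_closed Y T"
    using sub_closed_image[OF path_EM[OF P] X u] sub_closed_image[OF path_EM[OF Q] Y m]
    by (simp_all add: S_def T_def)
  let ?iS = "ident (substruct (fst X) S)" and ?iT = "ident (substruct (fst Y) T)"
  have fX: "f \<in> coalg_hom C X Y" using f by (simp add: open_morphism_def)
  \<comment> \<open>The restriction of \<open>f\<close> to the image of \<open>u\<close>. It lands
    in the image of \<open>m\<close> because of \<open>comm\<close>.\<close>
  define h where "h = compose S f ?iS"
  have hx: "h x = f x" if "x \<in> S" for x using that by (simp add: h_def compose_eq)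
  have gx: "g x \<in> carrier (fst Q)" if "x \<in> carrier (fst P)" for x
    by (rule hom_carrier[OF coalg_hom_hom[OF g] that])
  have "h \<in> coalg_hom C (subcoalg X S) Y"
    using coalg_hom_compose[OF subcoalg_EM[OF X S] X Y ident_coalg_hom_subcoalg[OF X S] fX]
    by (simp add: h_def)
  moreover have hT: "h ` S \<subseteq> T"
    using hx comm gx by (auto simp: S_def T_def)
  ultimately have h: "h \<in> coalg_hom C (subcoalg X S) (subcoalg Y T)"
    using coalg_hom_subcoalgI[OF subcoalg_EM[OF X S] Y T] by simp
  have "compose S f ?iS = compose S ?iT h"
    using compose_incl[of h "substruct (fst X) S" T "fst Y"] hT by (simp add: h_def)
  \<comment> \<open>Openness of \<open>f\<close>, for the square formed by \<open>h\<close> and the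
    inclusions of the two images.\<close>
  then obtain d where d: "d \<in> coalg_hom C (subcoalg Y T) X"
    and dS: "?iS = compose S d h" and dT: "?iT = compose T f d"
    using f h path_embedding_image[OF P X u] path_embedding_image[OF Q Y m]
    unfolding open_morphism_def S_def[symmetric] T_def[symmetric] by fastforce
  have dh: "d (f x) = x" if "x \<in> S" for x
    using fun_cong[OF dS, of x] that hx by (simp add: compose_eq)
  have fd: "f (d y) = y" if "y \<in> T" for y
    using fun_cong[OF dT, of y] that by (simp add: compose_eq)
  have mT: "m \<in> coalg_hom C Q (subcoalg Y T)"
    by (rule coalg_hom_subcoalgI[OF path_EM[OF Q] Y T m]) (simp add: T_def)
  \<comment> \<open>The required lift: \<open>m\<close>, corestricted to its image, followed by
    \<open>d\<close>.\<close>
  have "compose (carrier (fst Q)) d m \<in> coalg_hom C Q X"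
    by (rule coalg_hom_compose[OF path_EM[OF Q] subcoalg_EM[OF Y T] X mT d])
  moreover have "compose (carrier (fst P)) (compose (carrier (fst Q)) d m) g = u"
    using hom_extensional[OF coalg_hom_hom[OF u]] gx comm[symmetric] dh
    by (auto intro!: extensionalityI[of _ "carrier (fst P)"] simp: compose_eq S_def)
  moreover have "compose (carrier (fst Q)) f (compose (carrier (fst Q)) d m) = m"
    using hom_extensional[OF coalg_hom_hom[OF m]] fd
    by (auto intro!: extensionalityI[of _ "carrier (fst Q)"] simp: compose_eq T_def)
  ultimately show ?thesis by blast
qed

text \<open>The defining property of \<open>f\<close> is applied to the inclusion of the image of
  \<open>u\<close>, a path embedding even when \<open>u\<close> is not.\<close>

lemma pathwise_embedding_image:
  assumes X: "X \<in> EM K C" and f: "pathwise_embedding C Paths X Y f"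
    and P: "P \<in> Paths" and u: "u \<in> coalg_hom C P X"
  defines "S \<equiv> u ` carrier (fst P)"
  shows "embedding (substruct (fst X) S) (fst Y) (restrict f S)"
proof -
  have "compose S f (ident (substruct (fst X) S)) = restrict f S"
    by (auto simp: compose_def)
  then show ?thesis
    using f path_embedding_image[OF P X u] unfolding pathwise_embedding_def S_def[symmetric]
    by fastforce
qed

text \<open>A path embedding \<open>e\<close> into \<open>Z\<close> has components \<open>r\<close>
  and \<open>s\<close>, on whose images \<open>f\<close> and \<open>g\<close> restrict to
  embeddings. This gives \<open>k\<close> and \<open>l\<close> for
  \<open>embedding_cofree_prod\<close>; what remains is that \<open>r\<close> and \<open>s\<close>
  jointly embed the path into \<open>C\<close> of the product of these images.\<close>

lemma pathwise_embedding_prod: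
  assumes X: "X \<in> EM K C" and Y: "Y \<in> EM K C" and A: "A \<in> K" and B: "B \<in> K"
    and Z: "concrete_product X Y Z p q"
    and f: "pathwise_embedding C Paths X (cofree C A) f"
    and g: "pathwise_embedding C Paths Y (cofree C B) g"
  defines "h \<equiv> cofree_pair Z A B (compose (carrier (fst Z)) f p) (compose (carrier (fst Z)) g q)"
  shows "pathwise_embedding C Paths Z (cofree C (struct_prod pr A B)) h"
proof -
  let ?P = "struct_prod pr A B"
  let ?u = "compose (carrier (fst Z)) f p" and ?v = "compose (carrier (fst Z)) g q"
  note P = prod_K[OF A B]
  have ZE: "Z \<in> EM K C" and p: "p \<in> coalg_hom C Z X" and q: "q \<in> coalg_hom C Z Y"
    using Z by (auto simp: concrete_product_def)
  have fc: "f \<in> coalg_hom C X (cofree C A)" and gc: "g \<in> coalg_hom C Y (cofree C B)"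
    using f g by (auto simp: pathwise_embedding_def)
  note u = coalg_hom_compose[OF ZE X cofree_EM[OF A] p fc]
  note v = coalg_hom_compose[OF ZE Y cofree_EM[OF B] q gc]
  note h = cofree_pair[OF ZE A B u v, folded h_def]
  have "embedding (fst W) (Ob C ?P) (compose (carrier (fst W)) h e)"
    if We: "path_embedding C Paths W Z e" for W e
  proof -
    note Wp = path_embeddingD(1)[OF We] and e = path_embeddingD(2)[OF We]
      and ee = path_embeddingD(3)[OF We]
    note W = path_EM[OF Wp]
    define r s where "r = compose (carrier (fst W)) p e" and "s = compose (carrier (fst W)) q e"
    have r: "r \<in> coalg_hom C W X" and s: "s \<in> coalg_hom C W Y"
      unfolding r_def s_def
      by (rule coalg_hom_compose[OF W ZE X e p] coalg_hom_compose[OF W ZE Y e q])+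
    let ?D = "substruct (fst X) (r ` carrier (fst W))" and ?E = "substruct (fst Y) (s ` carrier (fst W))"
    note cr = sub_closed_image[OF W X r] and cs = sub_closed_image[OF W Y s]
    note D = sub_closed_K[OF X cr] and E = sub_closed_K[OF Y cs]
    have rD: "r \<in> hom (fst W) ?D" and sE: "s \<in> hom (fst W) ?E"
      using hom_substructI[OF coalg_hom_hom[OF r] EM_K[OF W] order_refl]
        hom_substructI[OF coalg_hom_hom[OF s] EM_K[OF W] order_refl] .
    note ex = hom_carrier[OF coalg_hom_hom[OF e]]
    show ?thesis
    proof (rule embedding_cofree_prod[OF W A B _ D E rD sE])
      show "compose (carrier (fst W)) h e \<in> coalg_hom C W (cofree C ?P)"
        by (rule coalg_hom_compose[OF W ZE cofree_EM[OF P] e h(1)])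
      show "embedding ?D (Ob C A) (restrict f (r ` carrier (fst W)))"
        using pathwise_embedding_image[OF X f Wp r] by simp
      show "embedding ?E (Ob C B) (restrict g (s ` carrier (fst W)))"
        using pathwise_embedding_image[OF Y g Wp s] by simp
      show "compose (carrier (fst W)) (Map_proj1 A B) (compose (carrier (fst W)) h e) =
          compose (carrier (fst W)) (restrict f (r ` carrier (fst W))) r"
        by (rule extensionalityI[of _ "carrier (fst W)"])
          (auto simp: compose_eq h(2) ex r_def)
      show "compose (carrier (fst W)) (Map_proj2 A B) (compose (carrier (fst W)) h e) =
          compose (carrier (fst W)) (restrict g (s ` carrier (fst W))) s"
        by (rule extensionalityI[of _ "carrier (fst W)"])
          (auto simp: compose_eq h(3) ex s_def)
      let ?Q = "struct_prod pr (fst X) (fst Y)" and ?R = "struct_prod pr ?D ?E"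
      let ?i = "ident ?D" and ?j = "ident ?E"
      have i: "?i \<in> hom ?D (fst X)" and j: "?j \<in> hom ?E (fst Y)"
        using sub_closed_incl[OF X cr] sub_closed_incl[OF Y cs] by (auto dest: embeddingD_hom)
      note R = prod_K[OF D E] and Q = prod_K[OF EM_K[OF X] EM_K[OF Y]]
      note rs = pair_hom[OF EM_K[OF W] rD sE]
      note ij = prod_map_hom[OF inj_pr D E R i j]
      have "compose (carrier (fst W)) ?i r = r" "compose (carrier (fst W)) ?j s = s"
        by (rule compose_incl[OF hom_extensional order_refl], rule rD sE)+
      then have "compose (carrier (fst W)) (prod_map pr ?D ?E ?i ?j) (pair pr (fst W) r s) = pair pr (fst W) r s"
        using prod_map_pair[OF inj_pr rD sE] by simp
      \<comment> \<open>Enlarging the images to \<open>X\<close> and \<open>Y\<close> turns the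
        transpose of the pair into \<open>e\<close>. The transpose is thus the first factor of an
        embedding.\<close>
      then have "compose (carrier (fst W)) (Map C ?R ?Q (prod_map pr ?D ?E ?i ?j))
          (transpose W ?R (pair pr (fst W) r s)) = transpose W ?Q (pair pr (fst W) r s)"
        using Map_compose_apply[OF EM_K[OF W] R Q rs ij] hom_carrier[OF EM_hom[OF W]]
        by (auto intro!: extensionalityI[of _ "carrier (fst W)"] simp: compose_eq transpose_def)
      also have "\<dots> = e"
        using Z W e unfolding concrete_product_def r_def s_def by metis
      finally have eq: "compose (carrier (fst W)) (Map C ?R ?Q (prod_map pr ?D ?E ?i ?j))
          (transpose W ?R (pair pr (fst W) r s)) = e" .
      have th: "transpose W ?R (pair pr (fst W) r s) \<in> hom (fst W) (Ob C ?R)"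
        using coalg_hom_hom[OF transpose_coalg_hom[OF W R rs]] by simp
      have "embedding (fst W) (Ob C ?Q) e"
        using Z W ee unfolding concrete_product_def by blast
      then show "embedding (fst W) (Ob C ?R) (transpose W ?R (pair pr (fst W) r s))"
        by (intro embedding_of_compose[OF th Map_hom[OF R Q ij]]) (simp only: eq)
    qed
  qed
  then show ?thesis using h(1) by (simp add: pathwise_embedding_def)
qed

text \<open>The lifting problem is split into components and solved in \<open>X\<close> and
  \<open>Y\<close>. The components are not embeddings in general, so
  \<open>open_morphism_lift\<close> is used in place of the definition of openness. The two lifts
  are joined by the universal property of \<open>Z\<close>.\<close>

lemma open_morphism_prod:
  assumes X: "X \<in> EM K C" and Y: "Y \<in> EM K C" and A: "A \<in> K" and B: "B \<in> K"
    and Z: "concrete_product X Y Z p q"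
    and f: "open_morphism C Paths X (cofree C A) f"
    and g: "open_morphism C Paths Y (cofree C B) g"
  defines "h \<equiv> cofree_pair Z A B (compose (carrier (fst Z)) f p) (compose (carrier (fst Z)) g q)"
  shows "open_morphism C Paths Z (cofree C (struct_prod pr A B)) h"
proof -
  let ?P = "struct_prod pr A B"
  note P = prod_K[OF A B] and pm = Map_proj_coalg_hom[OF A B]
  note FP = cofree_EM[OF P] and FA = cofree_EM[OF A] and FB = cofree_EM[OF B]
  have ZE: "Z \<in> EM K C" and p: "p \<in> coalg_hom C Z X" and q: "q \<in> coalg_hom C Z Y"
    using Z by (auto simp: concrete_product_def)
  have fc: "f \<in> coalg_hom C X (cofree C A)" and gc: "g \<in> coalg_hom C Y (cofree C B)"
    using f g by (auto simp: open_morphism_def)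
  note h = cofree_pair[OF ZE A B coalg_hom_compose[OF ZE X FA p fc] coalg_hom_compose[OF ZE Y FB q gc],
      folded h_def]
  have "\<exists>d\<in>coalg_hom C Q Z. e = compose (carrier (fst W)) d k \<and> m = compose (carrier (fst Q)) h d"
    if We: "path_embedding C Paths W Z e" and Qm: "path_embedding C Paths Q (cofree C ?P) m"
      and k: "k \<in> coalg_hom C W Q"
      and comm: "compose (carrier (fst W)) h e = compose (carrier (fst W)) m k" for W Q e m k
  proof -
    note Wp = path_embeddingD(1)[OF We] and e = path_embeddingD(2)[OF We]
    note Qp = path_embeddingD(1)[OF Qm] and m = path_embeddingD(2)[OF Qm]
    note W = path_EM[OF Wp] and Q = path_EM[OF Qp]
    note ex = hom_carrier[OF coalg_hom_hom[OF e]] and kx = hom_carrier[OF coalg_hom_hom[OF k]]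
    have hm: "h (e x) = m (k x)" if "x \<in> carrier (fst W)" for x
      using fun_cong[OF comm, of x] that by (simp add: compose_eq)
    define r s where "r = compose (carrier (fst W)) p e" and "s = compose (carrier (fst W)) q e"
    \<comment> \<open>The components of \<open>m\<close> under the view of
      \<open>cofree C ?P\<close> as the product of \<open>cofree C A\<close> and
      \<open>cofree C B\<close>.\<close>
    define m1 m2 where "m1 = compose (carrier (fst Q)) (Map_proj1 A B) m"
      and "m2 = compose (carrier (fst Q)) (Map_proj2 A B) m"
    have r: "r \<in> coalg_hom C W X" and s: "s \<in> coalg_hom C W Y"
      unfolding r_def s_def
      by (rule coalg_hom_compose[OF W ZE X e p] coalg_hom_compose[OF W ZE Y e q])+
    have m1: "m1 \<in> coalg_hom C Q (cofree C A)" and m2: "m2 \<in> coalg_hom C Q (cofree C B)"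
      unfolding m1_def m2_def
      by (rule coalg_hom_compose[OF Q FP FA m pm(1)] coalg_hom_compose[OF Q FP FB m pm(2)])+
    have "f (r x) = m1 (k x)" "g (s x) = m2 (k x)" if x: "x \<in> carrier (fst W)" for x
      using h(2)[OF ex[OF x]] h(3)[OF ex[OF x]] hm[OF x] x kx[OF x] ex[OF x]
      by (simp_all add: r_def s_def m1_def m2_def compose_eq)
    then obtain d1 d2 where
      d1: "d1 \<in> coalg_hom C Q X" "compose (carrier (fst W)) d1 k = r" "compose (carrier (fst Q)) f d1 = m1" and
      d2: "d2 \<in> coalg_hom C Q Y" "compose (carrier (fst W)) d2 k = s" "compose (carrier (fst Q)) g d2 = m2"
      using open_morphism_lift[OF X FA f Wp Qp r m1 k] open_morphism_lift[OF Y FB g Wp Qp s m2 k]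
      by blast
    obtain d where d: "d \<in> coalg_hom C Q Z"
      and pd: "compose (carrier (fst Q)) p d = d1" and qd: "compose (carrier (fst Q)) q d = d2"
      using Z Q d1(1) d2(1) unfolding concrete_product_def by blast
    have pdx: "p (d y) = d1 y" "q (d y) = d2 y" if "y \<in> carrier (fst Q)" for y
      using fun_cong[OF pd, of y] fun_cong[OF qd, of y] that by (simp_all add: compose_eq)
    have "compose (carrier (fst W)) p (compose (carrier (fst W)) d k) = compose (carrier (fst W)) d1 k"
      "compose (carrier (fst W)) q (compose (carrier (fst W)) d k) = compose (carrier (fst W)) d2 k"
      using pdx kx by (auto simp: compose_def)
    then have "compose (carrier (fst W)) p (compose (carrier (fst W)) d k) = compose (carrier (fst W)) p e"
      "compose (carrier (fst W)) q (compose (carrier (fst W)) d k) = compose (carrier (fst W)) q e"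
      using d1(2) d2(2) by (simp_all add: r_def s_def)
    moreover have "compose (carrier (fst W)) d k \<in> coalg_hom C W Z"
      by (rule coalg_hom_compose[OF W Q ZE k d])
    \<comment> \<open>Both arrows into \<open>Z\<close> have the components \<open>r\<close> and
      \<open>s\<close>, and both are transposes of the pair of these.\<close>
    ultimately have "e = compose (carrier (fst W)) d k"
      using Z W e unfolding concrete_product_def by metis
    moreover have "m = compose (carrier (fst Q)) h d"
    proof (rule Map_proj_jointly_monic[OF Q A B m])
      show "compose (carrier (fst Q)) h d \<in> coalg_hom C Q (cofree C ?P)"
        by (rule coalg_hom_compose[OF Q ZE FP d h(1)])
      fix y assume y: "y \<in> carrier (fst Q)"
      have dy: "d y \<in> carrier (fst Z)" by (rule hom_carrier[OF coalg_hom_hom[OF d] y])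
      show "Map_proj1 A B (m y) = Map_proj1 A B (compose (carrier (fst Q)) h d y)"
        using fun_cong[OF d1(3), of y] h(2)[OF dy] pdx[OF y] dy y by (simp add: m1_def compose_eq)
      show "Map_proj2 A B (m y) = Map_proj2 A B (compose (carrier (fst Q)) h d y)"
        using fun_cong[OF d2(3), of y] h(3)[OF dy] pdx[OF y] dy y by (simp add: m2_def compose_eq)
    qed
    ultimately show ?thesis using d by blast
  qed
  then show ?thesis using h(1) unfolding open_morphism_def by blast
qed

lemma comonad_equiv_prod:
  assumes A: "A\<^sub>1 \<in> K" "A\<^sub>2 \<in> K" and B: "B\<^sub>1 \<in> K" "B\<^sub>2 \<in> K"
    and "comonad_equiv K C Paths A\<^sub>1 B\<^sub>1" "comonad_equiv K C Paths A\<^sub>2 B\<^sub>2"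
  shows "comonad_equiv K C Paths (struct_prod pr A\<^sub>1 A\<^sub>2) (struct_prod pr B\<^sub>1 B\<^sub>2)"
proof -
  from assms(5) obtain X f g where X: "X \<in> EM K C"
    and f: "pathwise_embedding C Paths X (cofree C A\<^sub>1) f" "open_morphism C Paths X (cofree C A\<^sub>1) f"
    and g: "pathwise_embedding C Paths X (cofree C B\<^sub>1) g" "open_morphism C Paths X (cofree C B\<^sub>1) g"
    unfolding comonad_equiv_def by blast
  from assms(6) obtain Y f' g' where Y: "Y \<in> EM K C"
    and f': "pathwise_embedding C Paths Y (cofree C A\<^sub>2) f'" "open_morphism C Paths Y (cofree C A\<^sub>2) f'"
    and g': "pathwise_embedding C Paths Y (cofree C B\<^sub>2) g'" "open_morphism C Paths Y (cofree C B\<^sub>2) g'"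
    unfolding comonad_equiv_def by blast
  obtain Z p q where Z: "concrete_product X Y Z p q" using ex_concrete_product[OF X Y] by blast
  have "Z \<in> EM K C" using Z by (simp add: concrete_product_def)
  then show ?thesis
    unfolding comonad_equiv_def
    by (intro bexI exI conjI)
      (rule pathwise_embedding_prod[OF X Y A Z f(1) f'(1)] open_morphism_prod[OF X Y A Z f(2) f'(2)]
        pathwise_embedding_prod[OF X Y B Z g(1) g'(1)] open_morphism_prod[OF X Y B Z g(2) g'(2)])+
qed

end

theorem theorem7:
  fixes \<sigma> :: "'s signature"
    and \<U> :: "'u set set"
    and pr :: "'u \<times> 'u \<Rightarrow> 'u"
    and pointed :: bool
    and K :: "('s, 'u) rel_struct set"
    and C :: "('s, 'u) comonad"
    and Paths :: "('s, 'u) coalg set"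
    and A\<^sub>1 A\<^sub>2 B\<^sub>1 B\<^sub>2 :: "('s, 'u) rel_struct"
  assumes "set_universe pr \<U>"
    and "K = structs \<U> \<sigma> pointed"
    and "comonad_on K C"
    and "Paths \<subseteq> EM K C"
    and "preserves_embeddings K C"
    and "\<And>X Y f. \<lbrakk>X \<in> EM K C; Y \<in> EM K C; surjective_coalg_hom C X Y f; X \<in> Paths\<rbrakk> \<Longrightarrow> Y \<in> Paths"
    and "A\<^sub>1 \<in> K" and "A\<^sub>2 \<in> K" and "B\<^sub>1 \<in> K" and "B\<^sub>2 \<in> K"
    and "comonad_equiv K C Paths A\<^sub>1 B\<^sub>1"
    and "comonad_equiv K C Paths A\<^sub>2 B\<^sub>2"
  shows "comonad_equiv K C Paths (struct_prod pr A\<^sub>1 A\<^sub>2) (struct_prod pr B\<^sub>1 B\<^sub>2)"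
proof -
  have "path_comonad \<U> \<sigma> pointed C pr Paths"
    using assms(1,3-6) unfolding assms(2)
    by (intro path_comonad.intro embedding_comonad.intro embedding_comonad_axioms.intro
        path_comonad_axioms.intro)
  then show ?thesis
    using path_comonad.comonad_equiv_prod[OF _ assms(7-12)[unfolded assms(2)]] unfolding assms(2)
    by simp
qed

end
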